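(* Let $n\geq 4$ be an even integer and let $u\in C^\infty(\mathbb{R}^n)$. Consider the conformal metric $g=e^{2u}|dx|^2$ on $\mathbb{R}^n$ and assume that it has finite total Q-curvature, i.e. $Q_g e^{nu}\in L^1(\mathbb{R}^n)$. Suppose that $Q_g\leq (n-1)!$ on $\mathbb{R}^n$ and that the scalar curvature satisfies $R_g\geq 0$ near infinity (i.e. outside some compact set). Then $$\int_{\mathbb{R}^n}e^{nu}\,dx>\frac{|\mathbb{S}^n|}{2}.$$
   Context: For $g=e^{2u}|dx|^2$ on $\mathbb{R}^n$ with $n$ even and $u$ smooth, the Q-curvature $Q_g$ is the function defined by $(-\Delta)^{n/2}u=Q_g e^{nu}$ on $\mathbb{R}^n$, and the scalar curvature is $R_g=2(n-1)e^{-2u}\left(-\Delta u-\frac{n-2}{2}|\nabla u|^2\right)$, where $\Delta$ is the Euclidean Laplacian. $|\mathbb{S}^n|$ denotes the volume of the standard unit $n$-sphere. The integral $\int_{\mathbb{R}^n} e^{nu}dx$ (the volume of $g$) is allowed to be $+\infty$. *)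

theory Defs
  imports "HOL-Analysis.Analysis"
begin

definition partial_deriv :: "'a::euclidean_space \<Rightarrow> ('a \<Rightarrow> real) \<Rightarrow> 'a \<Rightarrow> real" where
  "partial_deriv b f x = frechet_derivative f (at x) b"

primrec C_k :: "nat \<Rightarrow> ('a::euclidean_space \<Rightarrow> real) \<Rightarrow> bool" where
  "C_k 0 f \<longleftrightarrow> continuous_on UNIV f"
| "C_k (Suc k) f \<longleftrightarrow> f differentiable_on UNIV \<and> (\<forall>b\<in>Basis. C_k k (partial_deriv b f))"

definition smooth :: "('a::euclidean_space \<Rightarrow> real) \<Rightarrow> bool" where
  "smooth f \<longleftrightarrow> (\<forall>k. C_k k f)"

definition gradient :: "('a::euclidean_space \<Rightarrow> real) \<Rightarrow> 'a \<Rightarrow> 'a" where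
  "gradient f x = (\<Sum>b\<in>Basis. partial_deriv b f x *\<^sub>R b)"

definition laplacian :: "('a::euclidean_space \<Rightarrow> real) \<Rightarrow> 'a \<Rightarrow> real" where
  "laplacian f x = (\<Sum>b\<in>Basis. partial_deriv b (partial_deriv b f) x)"

definition neg_laplacian :: "('a::euclidean_space \<Rightarrow> real) \<Rightarrow> 'a \<Rightarrow> real" where
  "neg_laplacian f = (\<lambda>x. - laplacian f x)"

text \<open>The metric \<open>g = exp (2 u) |dx|\<^sup>2\<close> on \<open>\<real>\<^sup>n\<close>, \<open>n = CARD('n)\<close>, is represented by its
  conformal exponent \<open>u\<close>. The Q-curvature is only meaningful for even \<open>n\<close>.\<close>

definition Q_curvature :: "(real^'n \<Rightarrow> real) \<Rightarrow> real^'n \<Rightarrow> real" where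
  "Q_curvature u x = (neg_laplacian ^^ (CARD('n) div 2)) u x / exp (real CARD('n) * u x)"

definition scalar_curvature :: "(real^'n \<Rightarrow> real) \<Rightarrow> real^'n \<Rightarrow> real" where
  "scalar_curvature u x =
     2 * (real CARD('n) - 1) * exp (- 2 * u x)
       * (- laplacian u x - (real CARD('n) - 2) / 2 * (norm (gradient u x))\<^sup>2)"

lemma Q_curvature_equation:
  fixes u :: "real^'n \<Rightarrow> real"
  shows "(neg_laplacian ^^ (CARD('n) div 2)) u x = Q_curvature u x * exp (real CARD('n) * u x)"
  by (simp add: Q_curvature_def)

text \<open>Surface measure on the unit sphere of a Euclidean space of dimension \<open>d\<close>, as it occurs in
  polar coordinates: \<open>d\<close> times the Lebesgue measure of the cone over \<open>A\<close> (since
  \<open>\<integral>\<^sub>0\<^sup>1 r\<^bsup>d-1\<^esup> dr = 1/d\<close>). Only used for Borel subsets \<open>A\<close> of the unit sphere.\<close>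

definition sphere_measure :: "'a::euclidean_space set \<Rightarrow> ennreal" where
  "sphere_measure A =
     of_nat DIM('a) * emeasure lborel {r *\<^sub>R x | r x. 0 < r \<and> r \<le> 1 \<and> x \<in> A}"

text \<open>\<open>|S\<^sup>n|\<close> for \<open>n = DIM('a)\<close>: the ambient \<open>\<real>\<^bsup>n+1\<^esup>\<close> is modelled by the product
  \<open>'a \<times> real\<close> with its Euclidean norm.\<close>

definition unit_sphere_volume :: "'a::euclidean_space itself \<Rightarrow> ennreal" where
  "unit_sphere_volume TYPE('a) = sphere_measure (sphere (0 :: 'a \<times> real) 1)"

lemma sphere_measure_unit_sphere:
  "sphere_measure (sphere (0::'a::euclidean_space) 1) =
     ennreal (2 * pi powr (DIM('a) / 2) / Gamma (DIM('a) / 2))"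
proof -
  have "{r *\<^sub>R x | r x. 0 < r \<and> r \<le> 1 \<and> x \<in> sphere (0::'a) 1} = cball 0 1 - {0}"
  proof (intro set_eqI iffI)
    fix y :: 'a assume y: "y \<in> cball 0 1 - {0}"
    then have "y = norm y *\<^sub>R (y /\<^sub>R norm y)" "norm (y /\<^sub>R norm y) = 1" "0 < norm y" "norm y \<le> 1"
      by auto
    then show "y \<in> {r *\<^sub>R x | r x. 0 < r \<and> r \<le> 1 \<and> x \<in> sphere (0::'a) 1}"
      unfolding mem_Collect_eq mem_sphere_0 by blast
  qed auto
  moreover have "emeasure lborel (cball (0::'a) 1 - {0}) = ennreal (unit_ball_vol DIM('a))"
    by (subst emeasure_Diff) (auto simp: emeasure_cball)
  moreover have "real DIM('a) * unit_ball_vol DIM('a) = 2 * pi powr (DIM('a) / 2) / Gamma (DIM('a) / 2)"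
  proof -
    define d where "d = real DIM('a)"
    have d: "d > 0" by (simp add: d_def)
    then have "d / 2 \<notin> \<int>\<^sub>\<le>\<^sub>0" by (auto elim!: nonpos_Ints_cases)
    then have *: "Gamma (d / 2 + 1) = d / 2 * Gamma (d / 2)" by (rule Gamma_plus1)
    have "Gamma (d / 2) > 0" using d by (simp add: Gamma_real_pos)
    with d show ?thesis unfolding unit_ball_vol_def d_def[symmetric] * by (simp add: field_simps)
  qed
  ultimately show ?thesis
    by (simp add: sphere_measure_def ennreal_of_nat_eq_real_of_nat flip: ennreal_mult')
qed

lemma unit_sphere_volume_eq:
  "unit_sphere_volume TYPE(real^'n) =
     ennreal (2 * pi powr ((real CARD('n) + 1) / 2) / Gamma ((real CARD('n) + 1) / 2))"
  by (simp add: unit_sphere_volume_def sphere_measure_unit_sphere add.commute)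

end

theory Submission
  imports Defs "HOL-Computational_Algebra.Polynomial"
begin

text \<open>
  Write \<open>n = 2m\<close>, let \<open>E = x \<cdot> \<nabla>\<close> be the Euler operator and average over spheres (here: over the
  shells \<open>r < |x| < 2 r\<close>, with a fixed radial weight) of radius \<open>r = exp t\<close>. Averaging turns \<open>E\<close> into \<open>d/dt\<close> and
  \<open>|x|\<^bsup>n\<^esup> (-\<Delta>)\<^sup>m\<close> into \<open>- (d/dt)\<^sup>2 \<Prod>j=1..m-1. (4 j\<^sup>2 - (d/dt)\<^sup>2)\<close>. So the mean \<open>z\<close> of \<open>E u\<close> satisfies
  \<open>\<Prod>j=1..m-1. (4 j\<^sup>2 - (d/dt)\<^sup>2) z = - F\<close>, where \<open>F\<close> is the total Q-curvature inside radius \<open>exp t\<close> up to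
  a constant factor.
  If the volume were at most half that of the sphere, then \<open>Q \<le> (n-1)!\<close> would give
  \<open>F \<le> \<Prod>j=1..m-1. 4 j\<^sup>2\<close> for all \<open>t\<close>, that is \<open>\<Prod>j=1..m-1. (4 j\<^sup>2 - (d/dt)\<^sup>2) (z + 1) \<ge> 0\<close>.
  Nonnegative scalar curvature near infinity yields, by the Cauchy-Schwarz inequality,
  \<open>z' \<le> - (n-2) z (1 + z/2)\<close> for large \<open>t\<close>, which excludes exponential growth of \<open>z\<close>. A maximum
  principle then gives \<open>z \<ge> -1\<close>, so the mean of \<open>u\<close> plus \<open>t\<close> is nondecreasing. By Jensen's
  inequality each dyadic shell has volume bounded from below, contradicting finiteness of the volume.
\<close>

section \<open>Smooth functions and the divergence theorem\<close>

lemma partial_deriv_eq: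
  assumes "(f has_derivative f') (at x)"
  shows "partial_deriv b f x = f' b"
  using frechet_derivative_at[OF assms] by (simp add: partial_deriv_def)

lemma C_k_differentiable: "C_k (Suc k) f \<Longrightarrow> f differentiable (at x)"
  by (auto simp: differentiable_on_def)

lemma has_derivative_partial_derivs:
  assumes "f differentiable (at x)"
  shows "(f has_derivative (\<lambda>h. \<Sum>b\<in>Basis. (h \<bullet> b) * partial_deriv b f x)) (at x)"
proof -
  let ?D = "frechet_derivative f (at x)"
  have "bounded_linear ?D" and D: "(f has_derivative ?D) (at x)"
    using assms frechet_derivative_works has_derivative_bounded_linear by blast+
  then interpret bounded_linear ?D by simp
  have "?D h = (\<Sum>b\<in>Basis. (h \<bullet> b) * partial_deriv b f x)" for h
    using sum[of "\<lambda>b. (h \<bullet> b) *\<^sub>R b" Basis]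
    by (simp add: scaleR euclidean_representation partial_deriv_def)
  then have "?D = (\<lambda>h. \<Sum>b\<in>Basis. (h \<bullet> b) * partial_deriv b f x)" by blast
  with D show ?thesis by metis
qed

lemma C_k_continuous: "C_k k f \<Longrightarrow> continuous_on UNIV f"
  by (cases k) (auto intro: differentiable_imp_continuous_on)

lemma C_k_SucD: "C_k (Suc k) f \<Longrightarrow> C_k k f"
proof (induction k arbitrary: f)
  case 0
  then show ?case using C_k_continuous C_k.simps(1) by blast
next
  case (Suc k)
  then show ?case unfolding C_k.simps(2)[of "Suc k"] C_k.simps(2)[of k f] by blast
qed

lemma C_k_const: "C_k k (\<lambda>x::'a::euclidean_space. c)"
proof (induction k arbitrary: c)
  case (Suc k)
  have "partial_deriv b (\<lambda>x::'a. c) = (\<lambda>x. 0)" for b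
    by (rule ext, subst partial_deriv_eq[OF has_derivative_const]) simp
  with Suc show ?case by simp
qed simp

lemma C_k_inner: "C_k k (\<lambda>x::'a::euclidean_space. x \<bullet> v)"
proof (cases k)
  case (Suc l)
  have d: "((\<lambda>x::'a. x \<bullet> v) has_derivative (\<lambda>h. h \<bullet> v)) (at x)" for x
    by (auto intro!: derivative_eq_intros)
  have "partial_deriv b (\<lambda>x::'a. x \<bullet> v) = (\<lambda>x. b \<bullet> v)" for b
    by (rule ext) (rule partial_deriv_eq[OF d])
  moreover have "(\<lambda>x::'a. x \<bullet> v) differentiable_on UNIV"
    using d differentiable_at_imp_differentiable_on differentiable_def by blast
  ultimately show ?thesis using Suc by (simp add: C_k_const)
qed (auto intro: continuous_intros)

lemma partial_deriv_add:
  assumes "f differentiable (at x)" "g differentiable (at x)"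
  shows "partial_deriv b (\<lambda>x. f x + g x) x = partial_deriv b f x + partial_deriv b g x"
proof -
  note fg = assms[unfolded frechet_derivative_works]
  show ?thesis unfolding partial_deriv_eq[OF has_derivative_add[OF fg]]
    by (simp add: partial_deriv_def)
qed

lemma partial_deriv_mult:
  assumes "f differentiable (at x)" "g differentiable (at x)"
  shows "partial_deriv b (\<lambda>x. f x * g x) x = f x * partial_deriv b g x + partial_deriv b f x * g x"
proof -
  note fg = assms[unfolded frechet_derivative_works]
  show ?thesis unfolding partial_deriv_eq[OF has_derivative_mult[OF fg]]
    by (simp add: partial_deriv_def)
qed

lemma C_k_add: "C_k k f \<Longrightarrow> C_k k g \<Longrightarrow> C_k k (\<lambda>x. f x + g x)"
proof (induction k arbitrary: f g)
  case (Suc k)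
  have "partial_deriv b (\<lambda>x. f x + g x) = (\<lambda>x. partial_deriv b f x + partial_deriv b g x)" for b
    using Suc.prems C_k_differentiable by (intro ext partial_deriv_add) blast+
  with Suc show ?case by (auto intro!: differentiable_on_add)
qed (auto intro: continuous_intros)

lemma C_k_mult: "C_k k f \<Longrightarrow> C_k k g \<Longrightarrow> C_k k (\<lambda>x. f x * g x)"
proof (induction k arbitrary: f g)
  case (Suc k)
  have "partial_deriv b (\<lambda>x. f x * g x) = (\<lambda>x. f x * partial_deriv b g x + partial_deriv b f x * g x)" for b
    using Suc.prems C_k_differentiable by (intro ext partial_deriv_mult) blast+
  moreover have "C_k k f" "C_k k g" using Suc.prems C_k_SucD by blast+
  ultimately show ?case using Suc by (auto intro!: differentiable_on_mult C_k_add)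
qed (auto intro: continuous_intros)

lemma smooth_differentiable: "smooth f \<Longrightarrow> f differentiable (at x)"
  unfolding smooth_def using C_k_differentiable by blast

lemma smooth_continuous: "smooth f \<Longrightarrow> continuous_on S f"
  unfolding smooth_def using C_k_continuous continuous_on_subset by blast

lemma smooth_partial_deriv: "smooth f \<Longrightarrow> b \<in> Basis \<Longrightarrow> smooth (partial_deriv b f)"
  unfolding smooth_def using C_k.simps(2) by blast

lemma smooth_const: "smooth (\<lambda>x. c)"
  by (simp add: smooth_def C_k_const)

lemma smooth_inner: "smooth (\<lambda>x. x \<bullet> v)"
  by (simp add: smooth_def C_k_inner)

lemma smooth_add: "smooth f \<Longrightarrow> smooth g \<Longrightarrow> smooth (\<lambda>x. f x + g x)"
  by (simp add: smooth_def C_k_add)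

lemma smooth_mult: "smooth f \<Longrightarrow> smooth g \<Longrightarrow> smooth (\<lambda>x. f x * g x)"
  by (simp add: smooth_def C_k_mult)

lemma smooth_minus: "smooth f \<Longrightarrow> smooth (\<lambda>x. - f x)"
  using smooth_mult[OF smooth_const[of "-1"]] by simp

lemma smooth_sum: "(\<And>i. i \<in> I \<Longrightarrow> smooth (f i)) \<Longrightarrow> smooth (\<lambda>x. \<Sum>i\<in>I. f i x)"
  by (induction I rule: infinite_finite_induct) (auto intro: smooth_const smooth_add)

lemma smooth_power: "smooth f \<Longrightarrow> smooth (\<lambda>x. f x ^ k)"
  by (induction k) (auto intro: smooth_const smooth_mult)

lemma smooth_norm_square: "smooth (\<lambda>x::'a::euclidean_space. x \<bullet> x)"
proof -
  have "smooth (\<lambda>x::'a. \<Sum>b\<in>Basis. (x \<bullet> b) * (x \<bullet> b))"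
    by (intro smooth_sum smooth_mult smooth_inner)
  then show ?thesis by (simp only: euclidean_inner[symmetric])
qed

lemma smooth_neg_laplacian: "smooth f \<Longrightarrow> smooth (neg_laplacian f)"
  unfolding neg_laplacian_def laplacian_def
  by (intro smooth_minus smooth_sum smooth_partial_deriv)

lemma smooth_neg_laplacian_funpow: "smooth f \<Longrightarrow> smooth ((neg_laplacian ^^ k) f)"
  by (induction k) (auto intro: smooth_neg_laplacian)

section \<open>The Euler operator, that is, the radial derivative \<open>r d/dr\<close>\<close>

definition euler :: "('a::euclidean_space \<Rightarrow> real) \<Rightarrow> 'a \<Rightarrow> real" where
  "euler f x = (\<Sum>b\<in>Basis. (x \<bullet> b) * partial_deriv b f x)"

lemma smooth_euler: "smooth f \<Longrightarrow> smooth (euler f)"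
  unfolding euler_def[abs_def] by (intro smooth_sum smooth_mult smooth_partial_deriv smooth_inner)

lemma smooth_euler_funpow: "smooth f \<Longrightarrow> smooth ((euler ^^ k) f)"
  by (induction k) (auto intro: smooth_euler)

text \<open>Means over shells concentrate at the origin as \<open>t\<close> tends to minus infinity,
  so this is why means of Euler derivatives vanish in that limit.\<close>

lemma euler_at_0: "euler f 0 = 0"
  by (simp add: euler_def)

lemma euler_add:
  "smooth f \<Longrightarrow> smooth g \<Longrightarrow> euler (\<lambda>x. f x + g x) x = euler f x + euler g x"
  unfolding euler_def
  by (simp add: partial_deriv_add smooth_differentiable algebra_simps sum.distrib)

lemma euler_mult:
  "smooth f \<Longrightarrow> smooth g \<Longrightarrow> euler (\<lambda>x. f x * g x) x = f x * euler g x + euler f x * g x"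
  unfolding euler_def
  by (simp add: partial_deriv_mult smooth_differentiable algebra_simps sum.distrib sum_distrib_left)

lemma euler_const: "euler (\<lambda>x. c) x = 0"
  unfolding euler_def by (simp add: partial_deriv_eq[OF has_derivative_const])

lemma sum_inner_square: "(\<Sum>b\<in>Basis. (x \<bullet> b) * (x \<bullet> b)) = x \<bullet> x"
  by (simp only: euclidean_inner[symmetric])

lemma euler_norm_square: "euler (\<lambda>x. x \<bullet> x) x = 2 * (x \<bullet> (x::'a::euclidean_space))"
proof -
  have d: "((\<lambda>x::'a. x \<bullet> x) has_derivative (\<lambda>h. 2 * (x \<bullet> h))) (at x)" for x
    by (auto intro!: derivative_eq_intros simp: inner_commute)
  show ?thesis unfolding euler_def partial_deriv_eq[OF d]
    by (simp only: mult.left_commute[of _ 2] sum_distrib_left[symmetric] sum_inner_square)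
qed

lemma euler_norm_power: "euler (\<lambda>x. (x \<bullet> x) ^ k) x = 2 * real k * (x \<bullet> x) ^ k"
proof (induction k)
  case (Suc k)
  then show ?case
    by (simp add: euler_mult smooth_power smooth_norm_square euler_norm_square algebra_simps)
qed (simp add: euler_const)

text \<open>Conjugation by \<open>|x|^(2 k)\<close> shifts the Euler operator by \<open>2 k\<close>.
  This is the source of the shifted linear factors in the polynomial of
  \<open>(-\<Delta>)^k\<close>.\<close>

lemma euler_norm_power_mult:
  assumes "smooth f"
  shows "euler (\<lambda>x. (x \<bullet> x) ^ k * f x) x = (x \<bullet> x) ^ k * (euler f x + 2 * real k * f x)"
  by (simp add: euler_mult smooth_power smooth_norm_square euler_norm_power assms algebra_simps)

text \<open>Cauchy-Schwarz for \<open>x \<bullet> gradient f x\<close>. It brings the gradient term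
  of the scalar curvature down to the radial derivative.\<close>

lemma euler_square_le: "(euler f x)\<^sup>2 \<le> (x \<bullet> x) * (norm (gradient f x))\<^sup>2"
proof -
  have "euler f x = x \<bullet> gradient f x"
    by (simp add: euler_def gradient_def inner_sum_right mult.commute)
  then show ?thesis
    using Cauchy_Schwarz_ineq[of x "gradient f x"] by (simp add: power2_norm_eq_inner)
qed

section \<open>Integrals of derivatives of compactly supported functions\<close>

lemma integrable_compact_support:
  fixes f :: "'a::euclidean_space \<Rightarrow> real"
  assumes "continuous_on UNIV f" "\<And>x. norm x > R \<Longrightarrow> f x = 0"
  shows "integrable lborel f"
proof -
  have "integrable lborel (\<lambda>x. indicator (cball 0 R) x *\<^sub>R f x)"
    by (rule borel_integrable_compact) (auto intro: continuous_on_subset assms(1))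
  moreover have "(\<lambda>x. indicator (cball 0 R) x *\<^sub>R f x) = f"
    using assms(2) by (auto simp: indicator_def fun_eq_iff not_le)
  ultimately show ?thesis by simp
qed

lemma lborel_integral_translation:
  fixes f :: "'a::euclidean_space \<Rightarrow> real"
  assumes "f \<in> borel_measurable borel"
  shows "(\<integral>x. f (c + x) \<partial>lborel) = (\<integral>x. f x \<partial>lborel)"
proof -
  have "(\<integral>x. f x \<partial>lborel) = (\<integral>x. f x \<partial>distr lborel borel ((+) c))"
    by (simp add: lborel_distr_plus)
  also have "\<dots> = (\<integral>x. f (c + x) \<partial>lborel)"
    using assms by (intro integral_distr) auto
  finally show ?thesis by simp
qed

text \<open>By translation invariance of Lebesgue measure every difference quotient
  \<open>q k\<close> in direction \<open>b\<close> has integral 0. The quotients converge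
  dominatedly to the derivative.\<close>

lemma integral_directional_derivative_eq_0:
  fixes f :: "'a::euclidean_space \<Rightarrow> real"
  assumes f': "\<And>x. (f has_derivative f' x) (at x)"
    and cont: "continuous_on UNIV (\<lambda>x. f' x b)"
    and supp: "\<And>x. norm x > R \<Longrightarrow> f x = 0"
  shows "(\<integral>x. f' x b \<partial>lborel) = 0"
proof -
  \<comment> \<open>Outside radius \<open>\<bar>R\<bar> + norm b\<close> every quotient is 0. Inside
    it, the intermediate point of the mean value theorem moves by at most \<open>norm b\<close>, so
    it stays in \<open>S\<close>.\<close>
  define S where "S = cball (0::'a) (\<bar>R\<bar> + 2 * norm b)"
  define q where "q k x = (real k + 1) * (f (inverse (real k + 1) *\<^sub>R b + x) - f x)" for k x
  have contf: "continuous_on UNIV f"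
    using f' has_derivative_continuous_on has_derivative_at_withinI by blast
  then have borelf: "f \<in> borel_measurable borel" by (rule borel_measurable_continuous_onI)
  have "bounded ((\<lambda>x. f' x b) ` S)"
    unfolding S_def by (intro compact_imp_bounded compact_continuous_image compact_cball)
      (rule continuous_on_subset[OF cont], simp)
  then obtain B where B: "\<And>x. x \<in> S \<Longrightarrow> \<bar>f' x b\<bar> \<le> B"
    unfolding bounded_iff by auto
  have line: "((\<lambda>s. f (x + s *\<^sub>R b)) has_real_derivative f' (x + s *\<^sub>R b) b) (at s)" for x s
  proof -
    have "((\<lambda>s. x + s *\<^sub>R b) has_derivative (\<lambda>h. 0 + h *\<^sub>R b)) (at s)"
      by (intro has_derivative_add has_derivative_const has_derivative_scaleR_left has_derivative_ident)
    from has_derivative_compose[OF this, of f, OF f'[of "x + s *\<^sub>R b"]]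
    have "((\<lambda>s. f (x + s *\<^sub>R b)) has_derivative (\<lambda>h. f' (x + s *\<^sub>R b) (h *\<^sub>R b))) (at s)"
      by simp
    moreover have "(\<lambda>h. f' (x + s *\<^sub>R b) (h *\<^sub>R b)) = (*) (f' (x + s *\<^sub>R b) b)"
      using linear_scale[OF has_derivative_linear[OF f'[of "x + s *\<^sub>R b"]]]
      by (simp add: fun_eq_iff mult.commute)
    ultimately show ?thesis
      by (simp add: has_field_derivative_def)
  qed
  have q_bound: "norm (q k x) \<le> indicator S x * B" for k x
  proof (cases "x \<in> cball 0 (\<bar>R\<bar> + norm b)")
    case False
    let ?y = "inverse (real k + 1) *\<^sub>R b + x"
    have "norm (inverse (real k + 1) *\<^sub>R b) \<le> norm b"
      by (simp add: mult_left_le_one_le inverse_le_1_iff)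
    then have "norm ?y > R" using False norm_diff_ineq[of x "inverse (real k + 1) *\<^sub>R b"]
      by (simp add: add.commute)
    moreover have "norm x > R" using False norm_ge_zero[of b] unfolding mem_cball_0 by linarith
    ultimately have "q k x = 0" using supp by (simp add: q_def)
    moreover have "0 \<le> indicator S x * B"
      using B by (force simp: indicator_def)
    ultimately show ?thesis by simp
  next
    case True
    have "\<exists>z. 0 < z \<and> z < inverse (real k + 1) \<and>
        f (x + inverse (real k + 1) *\<^sub>R b) - f (x + 0 *\<^sub>R b) =
        (inverse (real k + 1) - 0) * f' (x + z *\<^sub>R b) b"
      by (rule MVT2) (use line in auto)
    then obtain z where z: "0 < z" "z < inverse (real k + 1)"
      and e: "f (x + inverse (real k + 1) *\<^sub>R b) - f x = inverse (real k + 1) * f' (x + z *\<^sub>R b) b"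
      by auto
    have "inverse (real k + 1) \<le> 1" by (simp add: inverse_le_1_iff)
    with z have "z \<le> 1" by linarith
    then have "norm (z *\<^sub>R b) \<le> norm b" using z by (simp add: mult_left_le_one_le)
    then have "x + z *\<^sub>R b \<in> S"
      using True norm_triangle_ineq[of x "z *\<^sub>R b"] by (simp add: S_def)
    moreover have "x \<in> S" using True norm_ge_zero[of b] unfolding S_def mem_cball_0 by linarith
    moreover have "q k x = f' (x + z *\<^sub>R b) b"
      unfolding q_def using e by (simp add: add.commute)
    ultimately show ?thesis using B by simp
  qed
  have q_lim: "(\<lambda>k. q k x) \<longlonglongrightarrow> f' x b" for x
  proof -
    have "((\<lambda>h. (f (x + h *\<^sub>R b) - f x) / h) \<longlongrightarrow> f' x b) (at 0)"
      using line[of x 0] by (simp add: DERIV_def)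
    moreover have "filterlim (\<lambda>k. inverse (real k + 1)) (at 0) sequentially"
      unfolding filterlim_at using LIMSEQ_inverse_real_of_nat
      by (auto simp: add.commute[of 1])
    ultimately have "(\<lambda>k. (f (x + inverse (real k + 1) *\<^sub>R b) - f x) / inverse (real k + 1)) \<longlonglongrightarrow> f' x b"
      by (rule filterlim_compose)
    then show ?thesis by (simp add: q_def divide_inverse mult.commute add.commute)
  qed
  have int: "integrable lborel f" by (rule integrable_compact_support[OF contf supp])
  have "(\<lambda>k. \<integral>x. q k x \<partial>lborel) \<longlonglongrightarrow> (\<integral>x. f' x b \<partial>lborel)"
  proof (rule integral_dominated_convergence)
    show "(\<lambda>x. f' x b) \<in> borel_measurable lborel"
      using borel_measurable_continuous_onI[OF cont] by simp
    show "q k \<in> borel_measurable lborel" for k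
      unfolding q_def[abs_def] using borelf by measurable
    show "integrable lborel (\<lambda>x. indicator S x * B)"
      using borel_integrable_compact[of S "\<lambda>x. B"] by (simp add: S_def)
  qed (use q_lim q_bound in auto)
  moreover have "(\<integral>x. q k x \<partial>lborel) = 0" for k
  proof -
    let ?c = "inverse (real k + 1) *\<^sub>R b"
    have "integrable lborel (\<lambda>x. f (?c + x))"
    proof (rule integrable_compact_support)
      show "continuous_on UNIV (\<lambda>x. f (?c + x))"
        by (intro continuous_on_compose2[OF contf] continuous_intros) auto
      fix x :: 'a assume "norm x > R + norm ?c"
      then have "norm (?c + x) > R" using norm_diff_ineq[of x ?c] by (simp add: add.commute)
      then show "f (?c + x) = 0" by (rule supp)
    qed
    then have "(\<integral>x. f (?c + x) - f x \<partial>lborel) = 0"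
      using int by (simp add: lborel_integral_translation[OF borelf])
    then show ?thesis unfolding q_def by simp
  qed
  ultimately show ?thesis by (simp add: LIMSEQ_const_iff)
qed

lemma integral_divergence_eq_0:
  fixes V :: "'a::euclidean_space \<Rightarrow> 'a \<Rightarrow> real"
  assumes "\<And>b x. b \<in> Basis \<Longrightarrow> (V b has_derivative V' b x) (at x)"
    and cont: "\<And>b. b \<in> Basis \<Longrightarrow> continuous_on UNIV (\<lambda>x. V' b x b)"
    and supp: "\<And>b x. b \<in> Basis \<Longrightarrow> norm x > R \<Longrightarrow> V b x = 0"
  shows "(\<integral>x. (\<Sum>b\<in>Basis. V' b x b) \<partial>lborel) = 0"
proof -
  have "integrable lborel (\<lambda>x. V' b x b)" if b: "b \<in> Basis" for b
  proof (rule integrable_compact_support[OF cont[OF b], of R])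
    fix x :: 'a assume x: "norm x > R"
    have "(V b has_derivative (\<lambda>h. 0)) (at x)"
    proof (rule has_derivative_transform_within_open[of "\<lambda>x. 0"])
      show "open (- cball (0::'a) R)" by (simp add: open_Compl)
    qed (use x supp[OF b] in auto)
    from has_derivative_unique[OF assms(1)[OF b] this] show "V' b x b = 0" by simp
  qed
  then show ?thesis
    by (simp add: Bochner_Integration.integral_sum
        integral_directional_derivative_eq_0[OF assms(1) cont supp])
qed

section \<open>Radial weights\<close>

lemma derivative_eq_0_beyond_support:
  fixes G :: "real \<Rightarrow> real"
  assumes "\<And>s. (G has_real_derivative G' s) (at s)" "\<And>s. s > R \<Longrightarrow> G s = 0" "s > R"
  shows "G' s = 0"
proof -
  have "(G has_real_derivative 0) (at s)"
    by (rule DERIV_cong_ev[THEN iffD1, OF refl _ refl, of "\<lambda>s. 0"])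
      (use assms(2,3) eventually_nhds_in_open[of "{R<..}" s] in
        \<open>auto elim!: eventually_mono\<close>)
  with assms(1) show ?thesis using DERIV_unique by blast
qed

text \<open>Weights will be functions of \<open>x \<bullet> x\<close>. The crude radius
  \<open>\<bar>R\<bar> + 1\<close> avoids square roots and sign conditions on
  \<open>R\<close>.\<close>

lemma norm_square_gt:
  fixes x :: "'a::euclidean_space"
  assumes "norm x > \<bar>R\<bar> + 1"
  shows "x \<bullet> x > R"
proof -
  have "\<bar>R\<bar> + 1 \<le> (\<bar>R\<bar> + 1) * (\<bar>R\<bar> + 1)" by (rule mult_left_le_imp_le[of 1]) (simp_all add: algebra_simps)
  also have "\<dots> < norm x * norm x" using assms by (intro mult_strict_mono) auto
  finally show ?thesis by (simp add: power2_norm_eq_inner[symmetric] power2_eq_square)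
qed

lemma has_derivative_radial:
  assumes "(G has_real_derivative D) (at (x \<bullet> x))"
  shows "((\<lambda>x::'a::euclidean_space. G (x \<bullet> x)) has_derivative (\<lambda>h. 2 * D * (x \<bullet> h))) (at x)"
proof -
  have "((\<lambda>x::'a. x \<bullet> x) has_derivative (\<lambda>h. 2 * (x \<bullet> h))) (at x)"
    by (auto intro!: derivative_eq_intros simp: inner_commute)
  from has_derivative_compose[OF this assms[unfolded has_field_derivative_def]]
  show ?thesis by (simp add: mult.assoc mult.left_commute)
qed

lemma has_real_derivative_continuous:
  "(\<And>s. (G has_real_derivative G' s) (at s)) \<Longrightarrow> continuous_on UNIV G"
  using DERIV_isCont continuous_at_imp_continuous_on by blast

lemma integral_eq_integral_cbox:
  fixes f :: "'a::euclidean_space \<Rightarrow> real"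
  assumes "integrable lborel f" "\<And>x. x \<notin> cbox a b \<Longrightarrow> f x = 0"
  shows "(\<integral>x. f x \<partial>lborel) = integral (cbox a b) f"
proof -
  have "(f has_integral (\<integral>x. f x \<partial>lborel)) UNIV"
    by (rule has_integral_integral_lborel[OF assms(1)])
  moreover have "(\<lambda>x. if x \<in> cbox a b then f x else 0) = f" using assms(2) by auto
  ultimately have "(f has_integral (\<integral>x. f x \<partial>lborel)) (cbox a b)"
    using has_integral_restrict_UNIV[of "cbox a b" f] by simp
  then show ?thesis by (simp add: integral_unique)
qed

text \<open>The radius depends on \<open>s\<close> only, so one ball contains the supports of the
  dilated weights for all \<open>t < s\<close>. Differentiation under the integral sign relies on
  this uniformity.\<close>

lemma dilated_norm_square_gt:
  fixes x :: "'a::euclidean_space"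
  assumes "norm x > (\<bar>R\<bar> + 1) * exp s" "t < s"
  shows "(x \<bullet> x) * exp (- 2 * t) > R"
proof -
  have "norm (exp (- t) *\<^sub>R x) = exp (- t) * norm x" by simp
  also have "\<dots> > exp (- t) * ((\<bar>R\<bar> + 1) * exp s)"
    using assms(1) by (intro mult_strict_left_mono) auto
  also have "exp (- t) * ((\<bar>R\<bar> + 1) * exp s) = (\<bar>R\<bar> + 1) * exp (s - t)"
    by (simp add: exp_diff exp_minus field_simps)
  finally have "(\<bar>R\<bar> + 1) * exp (s - t) < norm (exp (- t) *\<^sub>R x)" .
  moreover have "(\<bar>R\<bar> + 1) * 1 \<le> (\<bar>R\<bar> + 1) * exp (s - t)"
    using assms(2) by (intro mult_left_mono) auto
  ultimately have "R < (exp (- t) *\<^sub>R x) \<bullet> (exp (- t) *\<^sub>R x)" by (intro norm_square_gt) simp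
  moreover have "(exp (- t) *\<^sub>R x) \<bullet> (exp (- t) *\<^sub>R x) = (x \<bullet> x) * (exp (- t) * exp (- t))"
    by simp
  moreover have "exp (- 2 * t) = exp (- t) * exp (- t)" by (simp add: exp_add[symmetric])
  ultimately show ?thesis by (simp add: mult_ac)
qed

section \<open>Integral identities for compactly supported C^1 radial weights\<close>

context
  fixes G G' :: "real \<Rightarrow> real" and R :: real
  assumes G': "\<And>s. (G has_real_derivative G' s) (at s)"
    and cont_G': "continuous_on UNIV G'"
    and supp: "\<And>s. s > R \<Longrightarrow> G s = 0"
begin

lemma continuous_on_radial:
  "continuous_on UNIV (\<lambda>x::'a::euclidean_space. G (x \<bullet> x))"
  "continuous_on UNIV (\<lambda>x::'a::euclidean_space. G' (x \<bullet> x))"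
  by (rule continuous_on_compose2[OF has_real_derivative_continuous[OF G']]
      continuous_on_compose2[OF cont_G'], (auto intro!: continuous_intros)[2])+

text \<open>Divergence theorem for \<open>G (|x|^2 grad \<psi> - x E\<psi>)\<close>. This field is
  orthogonal to \<open>x\<close>, so the terms with \<open>G'\<close> cancel. What remains is
  \<open>G\<close> times the spherical Laplacian of \<open>\<psi>\<close>, which is minus the
  integrand.\<close>

lemma integral_radial_laplacian:
  fixes \<psi> :: "'a::euclidean_space \<Rightarrow> real"
  assumes \<psi>: "smooth \<psi>"
  shows "(\<integral>x. G (x \<bullet> x) * ((x \<bullet> x) * neg_laplacian \<psi> x + euler (euler \<psi>) x
            + (real DIM('a) - 2) * euler \<psi> x) \<partial>lborel) = 0"
proof -
  define d where "d = (\<lambda>b. partial_deriv b \<psi>)"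
  define V where "V b x = G (x \<bullet> x) * ((x \<bullet> x) * d b x - (x \<bullet> b) * euler \<psi> x)" for b x
  define V' where "V' b x h = G (x \<bullet> x) * (((x \<bullet> x) * (\<Sum>c\<in>Basis. (h \<bullet> c) * partial_deriv c (d b) x)
      + 2 * 1 * (x \<bullet> h) * d b x) - ((x \<bullet> b) * (\<Sum>c\<in>Basis. (h \<bullet> c) * partial_deriv c (euler \<psi>) x)
      + (h \<bullet> b) * euler \<psi> x)) + 2 * G' (x \<bullet> x) * (x \<bullet> h) * ((x \<bullet> x) * d b x - (x \<bullet> b) * euler \<psi> x)"
    for b x h
  have smooth_d: "smooth (d b)" if "b \<in> Basis" for b
    unfolding d_def using smooth_partial_deriv[OF \<psi> that] .
  note sm = smooth_euler[OF \<psi>]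
  have "(\<integral>x. (\<Sum>b\<in>Basis. V' b x b) \<partial>lborel) = 0"
  proof (rule integral_divergence_eq_0[of V V' "\<bar>R\<bar> + 1"])
    fix b x :: 'a assume b: "b \<in> Basis"
    have i: "((\<lambda>x. x \<bullet> b) has_derivative (\<lambda>h. h \<bullet> b)) (at x)"
      by (auto intro!: derivative_eq_intros)
    have q: "((\<lambda>x. x \<bullet> x) has_derivative (\<lambda>h. 2 * 1 * (x \<bullet> h))) (at x)"
      by (rule has_derivative_radial[of "\<lambda>s. s"]) simp
    show "(V b has_derivative V' b x) (at x)"
      unfolding V_def[abs_def] V'_def[abs_def]
      by (intro has_derivative_mult has_derivative_diff has_derivative_radial[OF G'] i q
          has_derivative_partial_derivs smooth_differentiable sm smooth_d b)
  next
    fix b :: 'a assume b: "b \<in> Basis"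
    show "continuous_on UNIV (\<lambda>x. V' b x b)"
      unfolding V'_def
      by (intro continuous_intros continuous_on_radial smooth_continuous sm smooth_d b smooth_partial_deriv)
  next
    fix b x :: 'a assume "norm x > \<bar>R\<bar> + 1"
    then show "V b x = 0" using supp[OF norm_square_gt[of R x]] by (simp add: V_def)
  qed
  moreover have "(\<Sum>b\<in>Basis. V' b x b) = - (G (x \<bullet> x) * ((x \<bullet> x) * neg_laplacian \<psi> x + euler (euler \<psi>) x
            + (real DIM('a) - 2) * euler \<psi> x))" for x
  proof -
    have on: "(\<Sum>c\<in>Basis. (b \<bullet> c) * F c) = F b" if "b \<in> Basis" for b :: 'a and F :: "'a \<Rightarrow> real"
    proof -
      have "(\<Sum>c\<in>Basis. (b \<bullet> c) * F c) = (\<Sum>c\<in>Basis. if c = b then F c else 0)"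
        using that by (intro sum.cong) (auto simp: inner_Basis)
      then show ?thesis using that by simp
    qed
    have "V' b x b = G (x \<bullet> x) * ((x \<bullet> x) * partial_deriv b (d b) x) + 2 * G (x \<bullet> x) * ((x \<bullet> b) * d b x)
        - G (x \<bullet> x) * ((x \<bullet> b) * partial_deriv b (euler \<psi>) x) - G (x \<bullet> x) * euler \<psi> x
        + (2 * G' (x \<bullet> x) * (x \<bullet> x)) * ((x \<bullet> b) * d b x)
        - (2 * G' (x \<bullet> x) * euler \<psi> x) * ((x \<bullet> b) * (x \<bullet> b))" if "b \<in> Basis" for b
      using that unfolding V'_def on[OF that] by (simp add: inner_Basis algebra_simps)
    then have "(\<Sum>b\<in>Basis. V' b x b) = G (x \<bullet> x) * ((x \<bullet> x) * (\<Sum>b\<in>Basis. partial_deriv b (d b) x))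
        + 2 * G (x \<bullet> x) * (\<Sum>b\<in>Basis. (x \<bullet> b) * d b x)
        - G (x \<bullet> x) * (\<Sum>b\<in>Basis. (x \<bullet> b) * partial_deriv b (euler \<psi>) x)
        - real DIM('a) * (G (x \<bullet> x) * euler \<psi> x)
        + (2 * G' (x \<bullet> x) * (x \<bullet> x)) * (\<Sum>b\<in>Basis. (x \<bullet> b) * d b x)
        - (2 * G' (x \<bullet> x) * euler \<psi> x) * (\<Sum>b\<in>Basis. (x \<bullet> b) * (x \<bullet> b))"
      by (simp add: sum.distrib sum_subtractf sum_distrib_left)
    also have "\<dots> = - (G (x \<bullet> x) * ((x \<bullet> x) * neg_laplacian \<psi> x + euler (euler \<psi>) x
            + (real DIM('a) - 2) * euler \<psi> x))"
      unfolding sum_inner_square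
      by (simp add: neg_laplacian_def laplacian_def euler_def d_def algebra_simps)
    finally show ?thesis .
  qed
  ultimately show ?thesis by simp
qed

text \<open>Divergence theorem for the field \<open>G \<psi> x\<close>: the adjoint of the Euler
  operator \<open>E\<close> is \<open>- (n + E)\<close>, and \<open>E\<close> maps
  \<open>G (x \<bullet> x)\<close> to \<open>2 (x \<bullet> x) G' (x \<bullet> x)\<close>.\<close>

lemma integral_radial_euler:
  fixes \<psi> :: "'a::euclidean_space \<Rightarrow> real"
  assumes \<psi>: "smooth \<psi>"
  shows "(\<integral>x. (real DIM('a) * G (x \<bullet> x) + 2 * (x \<bullet> x) * G' (x \<bullet> x)) * \<psi> x \<partial>lborel)
    = - (\<integral>x. G (x \<bullet> x) * euler \<psi> x \<partial>lborel)"
proof -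
  define V where "V b x = (x \<bullet> b) * (G (x \<bullet> x) * \<psi> x)" for b x
  define V' where "V' b x h = (x \<bullet> b) * (G (x \<bullet> x) * (\<Sum>c\<in>Basis. (h \<bullet> c) * partial_deriv c \<psi> x)
      + 2 * G' (x \<bullet> x) * (x \<bullet> h) * \<psi> x) + (h \<bullet> b) * (G (x \<bullet> x) * \<psi> x)" for b x h
  have "(\<integral>x. (\<Sum>b\<in>Basis. V' b x b) \<partial>lborel) = 0"
  proof (rule integral_divergence_eq_0[of V V' "\<bar>R\<bar> + 1"])
    fix b x :: 'a assume b: "b \<in> Basis"
    have i: "((\<lambda>x. x \<bullet> b) has_derivative (\<lambda>h. h \<bullet> b)) (at x)"
      by (auto intro!: derivative_eq_intros)
    show "(V b has_derivative V' b x) (at x)"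
      unfolding V_def[abs_def] V'_def[abs_def]
      by (intro has_derivative_mult has_derivative_radial[OF G'] i
          has_derivative_partial_derivs smooth_differentiable \<psi>)
  next
    fix b :: 'a assume b: "b \<in> Basis"
    show "continuous_on UNIV (\<lambda>x. V' b x b)"
      unfolding V'_def
      by (intro continuous_intros continuous_on_radial smooth_continuous \<psi> b smooth_partial_deriv)
  next
    fix b x :: 'a assume "norm x > \<bar>R\<bar> + 1"
    then show "V b x = 0" using supp[OF norm_square_gt[of R x]] by (simp add: V_def)
  qed
  moreover have "(\<Sum>b\<in>Basis. V' b x b) =
      (real DIM('a) * G (x \<bullet> x) + 2 * (x \<bullet> x) * G' (x \<bullet> x)) * \<psi> x + G (x \<bullet> x) * euler \<psi> x" for x
  proof -
    have on: "(\<Sum>c\<in>Basis. (b \<bullet> c) * F c) = F b" if "b \<in> Basis" for b :: 'a and F :: "'a \<Rightarrow> real"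
    proof -
      have "(\<Sum>c\<in>Basis. (b \<bullet> c) * F c) = (\<Sum>c\<in>Basis. if c = b then F c else 0)"
        using that by (intro sum.cong) (auto simp: inner_Basis)
      then show ?thesis using that by simp
    qed
    have "V' b x b = G (x \<bullet> x) * ((x \<bullet> b) * partial_deriv b \<psi> x)
        + (2 * G' (x \<bullet> x) * \<psi> x) * ((x \<bullet> b) * (x \<bullet> b)) + G (x \<bullet> x) * \<psi> x" if "b \<in> Basis" for b
      using that unfolding V'_def on[OF that] by (simp add: inner_Basis algebra_simps)
    then have "(\<Sum>b\<in>Basis. V' b x b) = G (x \<bullet> x) * (\<Sum>b\<in>Basis. (x \<bullet> b) * partial_deriv b \<psi> x)
        + (2 * G' (x \<bullet> x) * \<psi> x) * (\<Sum>b\<in>Basis. (x \<bullet> b) * (x \<bullet> b)) + real DIM('a) * (G (x \<bullet> x) * \<psi> x)"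
      by (simp add: sum.distrib sum_distrib_left)
    then show ?thesis
      unfolding sum_inner_square by (simp add: euler_def algebra_simps)
  qed
  moreover have "integrable lborel (\<lambda>x. (real DIM('a) * G (x \<bullet> x) + 2 * (x \<bullet> x) * G' (x \<bullet> x)) * \<psi> x)"
    by (rule integrable_compact_support[of _ "\<bar>R\<bar> + 1"])
      (auto intro!: continuous_intros continuous_on_radial smooth_continuous[OF \<psi>]
        simp: supp norm_square_gt derivative_eq_0_beyond_support[OF G' supp])
  moreover have "integrable lborel (\<lambda>x. G (x \<bullet> x) * euler \<psi> x)"
    by (rule integrable_compact_support[of _ "\<bar>R\<bar> + 1"])
      (auto intro!: continuous_intros continuous_on_radial smooth_continuous[OF smooth_euler[OF \<psi>]]
        simp: supp norm_square_gt)
  ultimately show ?thesis by simp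
qed

lemma continuous_on_dilated:
  "continuous_on UNIV (\<lambda>x::'a::euclidean_space. G ((x \<bullet> x) * c))"
  "continuous_on UNIV (\<lambda>x::'a::euclidean_space. G' ((x \<bullet> x) * c))"
  by (rule continuous_on_compose2[OF has_real_derivative_continuous[OF G']]
      continuous_on_compose2[OF cont_G'], (auto intro!: continuous_intros)[2])+

lemma integrable_dilated:
  fixes \<psi> :: "'a::euclidean_space \<Rightarrow> real"
  assumes "continuous_on UNIV \<psi>"
  shows "integrable lborel (\<lambda>x. G ((x \<bullet> x) * exp (- 2 * t)) * \<psi> x)"
    and "integrable lborel (\<lambda>x. G' ((x \<bullet> x) * exp (- 2 * t)) * \<psi> x)"
  by (rule integrable_compact_support[of _ "(\<bar>R\<bar> + 1) * exp (t + 1)"],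
      auto intro!: continuous_intros continuous_on_dilated assms
        simp: supp dilated_norm_square_gt[where s="t + 1" and t=t and R=R, simplified]
          derivative_eq_0_beyond_support[OF G' supp])+

lemma has_derivative_dilated_integral:
  fixes \<psi> :: "'a::euclidean_space \<Rightarrow> real"
  assumes \<psi>: "continuous_on UNIV \<psi>"
  shows "((\<lambda>t. \<integral>x. G ((x \<bullet> x) * exp (- 2 * t)) * \<psi> x \<partial>lborel) has_real_derivative
    (\<integral>x. - 2 * ((x \<bullet> x) * exp (- 2 * t)) * G' ((x \<bullet> x) * exp (- 2 * t)) * \<psi> x \<partial>lborel)) (at t)"
proof -
  define U where "U = {t - 1 <..< t + 1}"
  define f where "f s x = G ((x \<bullet> x) * exp (- 2 * s)) * \<psi> x" for s x
  define f' where "f' s x = - 2 * ((x \<bullet> x) * exp (- 2 * s)) * G' ((x \<bullet> x) * exp (- 2 * s)) * \<psi> x" for s x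
  obtain a b :: 'a where ab: "cball 0 ((\<bar>R\<bar> + 1) * exp (t + 1)) \<subseteq> cbox a b"
    using bounded_subset_cbox_symmetric[OF bounded_cball] by metis
  have out: "(x \<bullet> x) * exp (- 2 * s) > R" if "x \<notin> cbox a b" "s \<in> U" for x :: 'a and s
    using that ab by (intro dilated_norm_square_gt[where s = "t + 1"]) (auto simp: U_def not_le)
  have f0: "f s x = 0" "f' s x = 0" if "x \<notin> cbox a b" "s \<in> U" for x s
    using supp derivative_eq_0_beyond_support[OF G' supp] out[OF that] by (auto simp: f_def f'_def)
  have contf: "continuous_on UNIV (f s)" for s
    unfolding f_def[abs_def] by (intro continuous_intros continuous_on_dilated \<psi>)
  have intf: "integrable lborel (f s)" for s
    unfolding f_def[abs_def] by (rule integrable_dilated[OF \<psi>])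
  have intf': "integrable lborel (f' s)" for s
  proof -
    have "continuous_on UNIV (\<lambda>x. - 2 * ((x \<bullet> x) * exp (- 2 * s)) * \<psi> x)"
      by (intro continuous_intros \<psi>)
    from integrable_dilated(2)[OF this, of s] show ?thesis
      unfolding f'_def by (simp add: mult_ac)
  qed
  have "((\<lambda>s. integral (cbox a b) (f s)) has_real_derivative integral (cbox a b) (f' t)) (at t within U)"
  proof (rule leibniz_rule_field_derivative)
    fix s :: real and x :: 'a
    have "((\<lambda>s::real. exp (- 2 * s)) has_real_derivative exp (- 2 * s) * - 2) (at s)"
      by (auto intro!: derivative_eq_intros)
    then have "((\<lambda>s. (x \<bullet> x) * exp (- 2 * s)) has_real_derivative (x \<bullet> x) * (exp (- 2 * s) * - 2)) (at s)"
      by (rule DERIV_cmult)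
    then have "((\<lambda>s. G ((x \<bullet> x) * exp (- 2 * s))) has_real_derivative
        G' ((x \<bullet> x) * exp (- 2 * s)) * ((x \<bullet> x) * (exp (- 2 * s) * - 2))) (at s)"
      by (rule DERIV_chain2[OF G'])
    from DERIV_cmult_right[OF this, of "\<psi> x"]
    have "((\<lambda>s. f s x) has_real_derivative f' s x) (at s)"
      unfolding f_def f'_def by (rule DERIV_cong) (simp only: mult_ac)
    then show "((\<lambda>s. f s x) has_real_derivative f' s x) (at s within U)"
      by (rule has_field_derivative_at_within)
  next
    show "f s integrable_on cbox a b" for s
      by (rule integrable_continuous) (rule continuous_on_subset[OF contf], simp)
  next
    have "continuous_on UNIV (\<lambda>p::real \<times> 'a. G' ((snd p \<bullet> snd p) * exp (- 2 * fst p)))"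
      by (rule continuous_on_compose2[OF cont_G']) (auto intro!: continuous_intros)
    moreover have "continuous_on UNIV (\<lambda>p::real \<times> 'a. \<psi> (snd p))"
      by (rule continuous_on_compose2[OF \<psi>]) (auto intro!: continuous_intros)
    ultimately have "continuous_on UNIV (\<lambda>p. f' (fst p) (snd p))"
      unfolding f'_def by (intro continuous_intros)
    then show "continuous_on (U \<times> cbox a b) (\<lambda>(s, x). f' s x)"
      by (simp add: case_prod_beta' continuous_on_subset[OF _ subset_UNIV])
  qed (auto simp: U_def)
  moreover have "open U" "t \<in> U" by (auto simp: U_def)
  ultimately have "((\<lambda>s. integral (cbox a b) (f s)) has_real_derivative integral (cbox a b) (f' t)) (at t)"
    using at_within_open by metis
  moreover have "integral (cbox a b) (f' t) = (\<integral>x. f' t x \<partial>lborel)"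
    using integral_eq_integral_cbox[OF intf' f0(2)] \<open>t \<in> U\<close> by simp
  moreover have "\<forall>\<^sub>F s in nhds t. integral (cbox a b) (f s) = (\<integral>x. f s x \<partial>lborel)"
    using eventually_nhds_in_open[OF \<open>open U\<close> \<open>t \<in> U\<close>]
    by eventually_elim (use integral_eq_integral_cbox[OF intf f0(1)] in simp)
  ultimately have "((\<lambda>s. \<integral>x. f s x \<partial>lborel) has_real_derivative (\<integral>x. f' t x \<partial>lborel)) (at t)"
    using DERIV_cong_ev[OF refl _ refl] by metis
  then show ?thesis by (simp add: f_def f'_def)
qed

text \<open>A layer-cake form of polar coordinates: write \<open>G (x \<bullet> x)\<close> as the
  integral of \<open>- G'\<close> from \<open>x \<bullet> x\<close> to \<open>R\<close> and exchange
  the integrals. The inner one is then the volume of a ball of radius \<open>sqrt \<tau>\<close>.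
  The difference \<open>h 0 - h R\<close> is half the integral of \<open>s^(m-1) G s\<close> over
  \<open>[0, R]\<close>.\<close>

lemma integral_radial:
  assumes m: "DIM('a::euclidean_space) = 2 * m" "m > 0" and "R > 0" "G R = 0"
    and h: "\<And>s. (h has_real_derivative - (s ^ (m - 1) * G s) / 2) (at s)"
  shows "(\<integral>x. G ((x::'a) \<bullet> x) \<partial>lborel) = real DIM('a) * unit_ball_vol DIM('a) * (h 0 - h R)"
proof -
  define S where "S = {p::'a \<times> real. fst p \<bullet> fst p \<le> snd p \<and> snd p \<le> R}"
  define f where "f x \<tau> = indicator S (x, \<tau>) *\<^sub>R (- G' \<tau>)" for x \<tau>
  let ?\<omega> = "unit_ball_vol DIM('a)"
  have "compact S"
  proof -
    have "closed S" unfolding S_def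
      by (intro closed_Collect_conj closed_Collect_le continuous_intros)
    moreover have "bounded S"
    proof (rule bounded_subset)
      show "S \<subseteq> cball 0 (sqrt R) \<times> {0..R}"
      proof
        fix p assume "p \<in> S"
        then have p: "fst p \<bullet> fst p \<le> snd p" "snd p \<le> R" by (auto simp: S_def)
        have "0 \<le> snd p" using p(1) inner_ge_zero[of "fst p"] by linarith
        moreover have "norm (fst p) \<le> sqrt R" using p by (simp add: norm_eq_sqrt_inner)
        ultimately show "p \<in> cball 0 (sqrt R) \<times> {0..R}" using p by (simp add: mem_Times_iff)
      qed
    qed (simp add: bounded_Times)
    ultimately show ?thesis by (simp add: compact_eq_bounded_closed)
  qed
  moreover have "continuous_on S (\<lambda>p. - G' (snd p))"
    by (intro continuous_intros continuous_on_compose2[OF cont_G']) auto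
  ultimately have "integrable lborel (\<lambda>p. indicator S p *\<^sub>R (- G' (snd p)))"
    by (rule borel_integrable_compact)
  then have "integrable (lborel \<Otimes>\<^sub>M lborel) (case_prod f)"
    unfolding lborel_prod by (simp add: f_def[abs_def] case_prod_beta')
  from lborel_pair.Fubini_integral[OF this]
  have eq: "(\<integral>x. \<integral>\<tau>. f x \<tau> \<partial>lborel \<partial>lborel) = (\<integral>\<tau>. \<integral>x. f x \<tau> \<partial>lborel \<partial>lborel)" by simp
  have "(\<integral>\<tau>. f x \<tau> \<partial>lborel) = G (x \<bullet> x)" for x :: 'a
  proof (cases "x \<bullet> x \<le> R")
    case True
    have "(\<integral>\<tau>. f x \<tau> \<partial>lborel) = (\<integral>\<tau>. indicator {x \<bullet> x..R} \<tau> *\<^sub>R (- G' \<tau>) \<partial>lborel)"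
      by (simp add: f_def S_def indicator_def)
    also have "\<dots> = - G R - (- G (x \<bullet> x))"
      by (rule integral_FTC_Icc[OF True])
        (auto intro!: continuous_intros continuous_on_subset[OF cont_G']
          has_field_derivative_at_within[OF DERIV_minus[OF G']]
          simp flip: has_real_derivative_iff_has_vector_derivative)
    finally show ?thesis using \<open>G R = 0\<close> by simp
  next
    case False
    then have "f x = (\<lambda>\<tau>. 0)" by (auto simp: f_def S_def indicator_def)
    then show ?thesis using supp False by simp
  qed
  moreover have "(\<integral>\<tau>. \<integral>x. f x \<tau> \<partial>lborel \<partial>lborel) = (2 * real m) * ?\<omega> * (h 0 - h R)"
  proof -
    have "(\<integral>x. f x \<tau> \<partial>lborel) = indicator {0..R} \<tau> *\<^sub>R (- G' \<tau> * \<tau> ^ m * ?\<omega>)" for \<tau>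
    proof (cases "\<tau> \<in> {0..R}")
      case True
      have "f x \<tau> = - G' \<tau> * indicator (cball 0 (sqrt \<tau>)) x" for x
        using True by (auto simp: f_def S_def indicator_def norm_eq_sqrt_inner)
      then have "(\<integral>x. f x \<tau> \<partial>lborel) = - G' \<tau> * measure lborel (cball (0::'a) (sqrt \<tau>))"
        by simp
      also have "measure lborel (cball (0::'a) (sqrt \<tau>)) = ?\<omega> * sqrt \<tau> ^ DIM('a)"
        using True by (intro content_cball) auto
      also have "sqrt \<tau> ^ DIM('a) = \<tau> ^ m" using True by (simp add: m power_mult)
      finally show ?thesis using True by (simp add: mult_ac)
    next
      case False
      have "f x \<tau> = 0" for x
        using False inner_ge_zero[of x] by (auto simp: f_def S_def indicator_def simp del: inner_ge_zero)
      then show ?thesis using False by simp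
    qed
    then have "(\<integral>\<tau>. \<integral>x. f x \<tau> \<partial>lborel \<partial>lborel)
        = (\<integral>\<tau>. indicator {0..R} \<tau> *\<^sub>R (- G' \<tau> * \<tau> ^ m * ?\<omega>) \<partial>lborel)" by simp
    \<comment> \<open>Integration by parts, built into the antiderivative: the derivative of
      \<open>- 2 m h\<close> is \<open>m \<tau>^(m-1) G\<close>, which cancels the unwanted term
      from the product rule.\<close>
    also have "\<dots> = (- G R * R ^ m - 2 * real m * h R) * ?\<omega> - (- G 0 * 0 ^ m - 2 * real m * h 0) * ?\<omega>"
    proof (rule integral_FTC_Icc)
      fix \<tau> :: real
      have "\<tau> ^ m = \<tau> ^ (m - 1) * \<tau>" using m by (metis power_minus_mult)
      then have "((\<lambda>\<tau>. (- G \<tau> * \<tau> ^ m - 2 * real m * h \<tau>) * ?\<omega>) has_real_derivative - G' \<tau> * \<tau> ^ m * ?\<omega>) (at \<tau>)"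
        by (auto intro!: derivative_eq_intros G' h simp: algebra_simps)
      then show "((\<lambda>\<tau>. (- G \<tau> * \<tau> ^ m - 2 * real m * h \<tau>) * ?\<omega>) has_vector_derivative
          - G' \<tau> * \<tau> ^ m * ?\<omega>) (at \<tau> within {0..R})"
        by (simp add: has_real_derivative_iff_has_vector_derivative has_vector_derivative_at_within)
    qed (use \<open>R > 0\<close> in \<open>auto intro!: continuous_intros continuous_on_subset[OF cont_G']\<close>)
    finally show ?thesis using m \<open>G R = 0\<close> by (simp add: algebra_simps)
  qed
  ultimately show ?thesis using eq m by simp
qed

end

section \<open>A maximum principle for an ordinary differential operator\<close>

text \<open>The sign \<open>\<sigma>\<close> is left open because inverting a factor
  \<open>\<mu> - d/dt\<close> reverses it.\<close>

definition grows :: "real \<Rightarrow> (real \<Rightarrow> real) \<Rightarrow> bool" where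
  "grows \<kappa> y \<longleftrightarrow> (\<exists>\<sigma>\<in>{1, -1}. \<exists>c>0. \<forall>\<^sub>F t in at_top. \<sigma> * y t \<ge> c * exp (\<kappa> * t))"

text \<open>With the integrating factor \<open>exp (- \<mu> t)\<close> the right-hand side becomes
  \<open>c exp ((\<kappa> - \<mu>) t)\<close>. Its integral is unbounded since
  \<open>\<mu> < \<kappa>\<close>, so it outweighs any initial value.\<close>

lemma exp_growth_step:
  fixes y y' :: "real \<Rightarrow> real"
  assumes y': "\<And>t. (y has_real_derivative y' t) (at t)"
    and "\<mu> < \<kappa>" "c > 0" and ev: "\<forall>\<^sub>F t in at_top. y' t - \<mu> * y t \<ge> c * exp (\<kappa> * t)"
  shows "\<exists>c'>0. \<forall>\<^sub>F t in at_top. y t \<ge> c' * exp (\<kappa> * t)"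
proof -
  obtain t1 where t1: "\<And>t. t \<ge> t1 \<Longrightarrow> y' t - \<mu> * y t \<ge> c * exp (\<kappa> * t)"
    using ev unfolding eventually_at_top_linorder by blast
  \<comment> \<open>\<open>D exp (\<kappa> t)\<close> satisfies the inequality with equality. Half
    of it is spent below on absorbing the initial value \<open>\<phi> t1\<close>.\<close>
  define D where "D = c / (\<kappa> - \<mu>)"
  have "D > 0" using assms by (simp add: D_def)
  have cD: "c = D * (\<kappa> - \<mu>)" using \<open>\<mu> < \<kappa>\<close> by (simp add: D_def)
  define \<phi> where "\<phi> t = exp (- \<mu> * t) * y t - D * exp ((\<kappa> - \<mu>) * t)" for t
  have \<phi>': "(\<phi> has_real_derivative exp (- \<mu> * t) * (y' t - \<mu> * y t) - c * exp ((\<kappa> - \<mu>) * t)) (at t)" for t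
    unfolding \<phi>_def[abs_def] cD
    by (auto intro!: derivative_eq_intros y' simp: algebra_simps)
  have mono: "\<phi> t1 \<le> \<phi> t" if "t \<ge> t1" for t
  proof (rule DERIV_nonneg_imp_nondecreasing[OF that])
    fix s assume "t1 \<le> s" "s \<le> t"
    have "exp (- \<mu> * s) * (c * exp (\<kappa> * s)) \<le> exp (- \<mu> * s) * (y' s - \<mu> * y s)"
      using t1[OF \<open>t1 \<le> s\<close>] by (intro mult_left_mono) auto
    moreover have "exp (- \<mu> * s) * (c * exp (\<kappa> * s)) = c * exp ((\<kappa> - \<mu>) * s)"
      by (simp add: exp_add[symmetric] algebra_simps)
    ultimately have "0 \<le> exp (- \<mu> * s) * (y' s - \<mu> * y s) - c * exp ((\<kappa> - \<mu>) * s)"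
      by linarith
    with \<phi>' show "\<exists>d. (\<phi> has_real_derivative d) (at s) \<and> d \<ge> 0" by blast
  qed
  have "filterlim (\<lambda>t. exp ((\<kappa> - \<mu>) * t)) at_top at_top"
    by (rule filterlim_compose[OF exp_at_top])
      (use \<open>\<mu> < \<kappa>\<close> in \<open>intro filterlim_tendsto_pos_mult_at_top[OF tendsto_const] filterlim_ident; simp\<close>)
  then have "\<forall>\<^sub>F t in at_top. exp ((\<kappa> - \<mu>) * t) \<ge> - \<phi> t1 / (D / 2)"
    by (simp add: filterlim_at_top)
  then have "\<forall>\<^sub>F t in at_top. y t \<ge> D / 2 * exp (\<kappa> * t)"
    using eventually_ge_at_top[of t1]
  proof eventually_elim
    fix t assume t: "exp ((\<kappa> - \<mu>) * t) \<ge> - \<phi> t1 / (D / 2)" "t \<ge> t1"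
    have "- \<phi> t1 \<le> D / 2 * exp ((\<kappa> - \<mu>) * t)"
      using t(1) \<open>D > 0\<close> by (simp add: field_simps)
    then have "D / 2 * exp ((\<kappa> - \<mu>) * t) \<le> exp (- \<mu> * t) * y t"
      using mono[OF t(2)] by (simp add: \<phi>_def)
    then have "exp (\<mu> * t) * (D / 2 * exp ((\<kappa> - \<mu>) * t)) \<le> exp (\<mu> * t) * (exp (- \<mu> * t) * y t)"
      by (intro mult_left_mono) auto
    moreover have "exp (\<mu> * t) * (D / 2 * exp ((\<kappa> - \<mu>) * t)) = D / 2 * exp (\<kappa> * t)"
      by (simp add: exp_add[symmetric] algebra_simps)
    moreover have "exp (\<mu> * t) * (exp (- \<mu> * t) * y t) = y t"
      by (simp add: mult.assoc[symmetric] exp_add[symmetric])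
    ultimately show "y t \<ge> D / 2 * exp (\<kappa> * t)" by linarith
  qed
  with \<open>D > 0\<close> show ?thesis by (intro exI[of _ "D / 2"]) simp
qed

text \<open>The differential inequality forces \<open>z\<close> to decrease where it is positive, and to blow up
  to \<open>-\<infinity>\<close> in finite time below \<open>-2\<close>.\<close>

lemma riccati_not_grows:
  fixes z z' :: "real \<Rightarrow> real"
  assumes z': "\<And>t. (z has_real_derivative z' t) (at t)"
    and ric: "\<And>t. t \<ge> T \<Longrightarrow> z' t \<le> - d * (z t * (1 + z t / 2))" and "d \<ge> 2" "\<kappa> > 0"
  shows "\<not> grows \<kappa> (\<lambda>t. z t + 1)"
proof
  assume "grows \<kappa> (\<lambda>t. z t + 1)"
  then obtain \<sigma> c where \<sigma>: "\<sigma> = 1 \<or> \<sigma> = -1" and "c > 0"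
    and ev: "\<forall>\<^sub>F t in at_top. \<sigma> * (z t + 1) \<ge> c * exp (\<kappa> * t)"
    unfolding grows_def by blast
  have lim: "filterlim (\<lambda>t. c * exp (\<kappa> * t)) at_top at_top"
    using \<open>c > 0\<close> \<open>\<kappa> > 0\<close>
    by (intro filterlim_tendsto_pos_mult_at_top[OF tendsto_const]
        filterlim_compose[OF exp_at_top] filterlim_ident) auto
  then have lim': "filterlim (\<lambda>t. \<sigma> * (z t + 1)) at_top at_top"
    using ev by (rule filterlim_at_top_mono)
  then have big: "\<forall>\<^sub>F t in at_top. \<sigma> * (z t + 1) \<ge> K" for K
    by (simp add: filterlim_at_top)
  \<comment> \<open>The threshold 3 means \<open>z >= 2\<close> for the positive sign and
    \<open>z <= -4\<close> for the negative one. The latter gives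
    \<open>z (1 + z/2) >= z^2 / 4\<close>.\<close>
  obtain T1 where T1: "\<And>t. t \<ge> T1 \<Longrightarrow> \<sigma> * (z t + 1) \<ge> 3"
    using big unfolding eventually_at_top_linorder by blast
  define T2 where "T2 = max T T1"
  show False
  proof (cases "\<sigma> = 1")
    case True
    have "z t \<le> z T2" if "t \<ge> T2" for t
    proof (rule DERIV_nonpos_imp_nonincreasing[OF that])
      fix s assume "T2 \<le> s" "s \<le> t"
      then have "z s \<ge> 2" "s \<ge> T" using T1[of s] True by (auto simp: T2_def)
      then have "0 \<le> d * (z s * (1 + z s / 2))" using \<open>d \<ge> 2\<close> by simp
      then show "\<exists>D. (z has_real_derivative D) (at s) \<and> D \<le> 0"
        using z' ric[OF \<open>s \<ge> T\<close>] by (intro exI[of _ "z' s"]) auto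
    qed
    moreover obtain t where "t \<ge> T2" "z t + 1 \<ge> z T2 + 2"
      using eventually_conj[OF big[of "z T2 + 2"] eventually_ge_at_top[of T2]] True
      unfolding eventually_at_top_linorder by auto
    ultimately show False by force
  next
    case False
    have z4: "z s \<le> -4" if "s \<ge> T2" for s
      using T1[of s] that False \<sigma> by (auto simp: T2_def)
    \<comment> \<open>\<open>1/z\<close> increases at speed at least 1/2. It starts at or above
      -1/4, so within one unit of time it would be positive although \<open>z\<close> is still
      negative.\<close>
    define y where "y s = inverse (z s) - s / 2" for s
    have "y T2 \<le> y t" if "t \<ge> T2" for t
    proof (rule DERIV_nonneg_imp_nondecreasing[OF that])
      fix s assume s: "T2 \<le> s" "s \<le> t"
      have z: "z s \<le> -4" "s \<ge> T" using z4 s by (auto simp: T2_def)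
      have "0 \<le> z s * (z s + 4)" using z(1) by (intro mult_nonpos_nonpos) auto
      then have "z s * z s / 4 \<le> z s * (1 + z s / 2)" by (simp add: algebra_simps)
      then have "2 * (z s * z s / 4) \<le> d * (z s * (1 + z s / 2))"
        using \<open>d \<ge> 2\<close> by (intro mult_mono) auto
      then have "z s * z s / 2 \<le> - z' s" using ric[OF z(2)] by simp
      then have "0 \<le> - (inverse (z s) * z' s * inverse (z s)) - 1 / 2"
        using z(1) by (simp add: divide_simps algebra_simps)
      moreover have "(y has_real_derivative - (inverse (z s) * z' s * inverse (z s)) - 1 / 2) (at s)"
        unfolding y_def[abs_def] using z(1)
        by (intro DERIV_diff DERIV_inverse' z' DERIV_cdivide DERIV_ident) auto
      ultimately show "\<exists>D. (y has_real_derivative D) (at s) \<and> D \<ge> 0" by blast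
    qed
    from this[of "T2 + 1"] have "inverse (z (T2 + 1)) \<ge> inverse (z T2) + 1 / 2"
      by (simp add: y_def field_simps)
    moreover have "inverse (z T2) \<ge> - 1 / 4" using z4[of T2] by (simp add: divide_simps)
    moreover have "inverse (z (T2 + 1)) < 0" using z4[of "T2 + 1"] by simp
    ultimately show False by simp
  qed
qed

text \<open>Models \<open>M p = p(d/dt) y\<close> for the fixed function \<open>y = M 1\<close>:
  multiplying \<open>p\<close> by its variable, \<open>pCons 0\<close>, is differentiation.
  Factoring a differential operator thus becomes factoring a polynomial.\<close>

locale shift_functional =
  fixes M :: "real poly \<Rightarrow> real \<Rightarrow> real"
  assumes add: "M (p + q) t = M p t + M q t"
    and smult: "M (smult c p) t = c * M p t"
    and deriv: "(M p has_real_derivative M (pCons 0 p) t) (at t)"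
begin

lemma linear_factor: "M ([:a, b:] * p) t = a * M p t + b * M (pCons 0 p) t"
proof -
  have "[:a, b:] * p = smult a p + smult b (pCons 0 p)" by simp
  then show ?thesis by (simp only: add smult)
qed

text \<open>The operator \<open>\<mu> + \<epsilon> d/dt\<close> has the characteristic root
  \<open>- \<epsilon> \<mu>\<close>. Growth at a rate above this root cannot come from the
  homogeneous solution, so it passes to \<open>M p\<close>, with sign
  \<open>\<sigma> \<epsilon>\<close>.\<close>

lemma grows_factor:
  assumes \<epsilon>: "\<epsilon> = 1 \<or> \<epsilon> = -1" and "- \<epsilon> * \<mu> < \<kappa>" "grows \<kappa> (M ([:\<mu>, \<epsilon>:] * p))"
  shows "grows \<kappa> (M p)"
proof -
  obtain \<sigma> c where \<sigma>: "\<sigma> = 1 \<or> \<sigma> = -1" and "c > 0"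
    and ev: "\<forall>\<^sub>F t in at_top. \<sigma> * M ([:\<mu>, \<epsilon>:] * p) t \<ge> c * exp (\<kappa> * t)"
    using assms(3) unfolding grows_def by blast
  have "\<exists>c'>0. \<forall>\<^sub>F t in at_top. \<sigma> * \<epsilon> * M p t \<ge> c' * exp (\<kappa> * t)"
  proof (rule exp_growth_step[OF _ assms(2) \<open>c > 0\<close>])
    show "((\<lambda>t. \<sigma> * \<epsilon> * M p t) has_real_derivative \<sigma> * \<epsilon> * M (pCons 0 p) t) (at t)" for t
      by (rule DERIV_cmult) (rule deriv)
    show "\<forall>\<^sub>F t in at_top. c * exp (\<kappa> * t) \<le> \<sigma> * \<epsilon> * M (pCons 0 p) t - - \<epsilon> * \<mu> * (\<sigma> * \<epsilon> * M p t)"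
      using ev[unfolded linear_factor] by eventually_elim (use \<epsilon> in \<open>auto simp: algebra_simps\<close>)
  qed
  moreover have "\<sigma> * \<epsilon> \<in> {1, -1}" using \<sigma> \<epsilon> by auto
  ultimately show ?thesis unfolding grows_def by blast
qed

text \<open>The roots \<open>2, 4, ..., 2 k\<close> all lie below \<open>\<kappa>\<close>. For the
  factors \<open>[:2 * real j, 1:]\<close> of the next lemma they are negative, so there every
  positive rate is above them.\<close>

lemma grows_prod_minus:
  assumes "grows \<kappa> (M ((\<Prod>j=1..k. [:2 * real j, -1:]) * p))" "2 * real k < \<kappa>"
  shows "grows \<kappa> (M p)"
  using assms
proof (induction k arbitrary: p)
  case (Suc k)
  have "grows \<kappa> (M ((\<Prod>j=1..k. [:2 * real j, -1:]) * ([:2 * real (Suc k), -1:] * p)))"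
    using Suc.prems(1) by (simp add: prod.nat_ivl_Suc' mult_ac del: mult_pCons_left mult_pCons_right)
  from Suc.IH[OF this] Suc.prems(2) have "grows \<kappa> (M ([:2 * real (Suc k), -1:] * p))" by simp
  then show ?case by (rule grows_factor[rotated 2]) (use Suc.prems(2) in auto)
qed simp

lemma grows_prod_plus:
  assumes "grows \<kappa> (M ((\<Prod>j=1..k. [:2 * real j, 1:]) * p))" "\<kappa> > 0"
  shows "grows \<kappa> (M p)"
  using assms
proof (induction k arbitrary: p)
  case (Suc k)
  have "grows \<kappa> (M ((\<Prod>j=1..k. [:2 * real j, 1:]) * ([:2 * real (Suc k), 1:] * p)))"
    using Suc.prems(1) by (simp add: prod.nat_ivl_Suc' mult_ac del: mult_pCons_left mult_pCons_right)
  from Suc.IH[OF this] Suc.prems(2) have "grows \<kappa> (M ([:2 * real (Suc k), 1:] * p))" by simp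
  then show ?case by (rule grows_factor[rotated 2]) (use Suc.prems(2) in auto)
qed simp

text \<open>The hypothesis makes \<open>exp (- \<kappa> t) M p\<close> nonincreasing. A negative
  value at \<open>t\<close> therefore persists and forces \<open>M p\<close> below a negative
  multiple of \<open>exp (\<kappa> s)\<close>.\<close>

lemma nonneg_if_not_grows:
  assumes nonneg: "\<And>t. M ([:\<kappa>, -1:] * p) t \<ge> 0" and "\<not> grows \<kappa> (M p)"
  shows "M p t \<ge> 0"
proof (rule ccontr)
  assume neg: "\<not> M p t \<ge> 0"
  define \<phi> where "\<phi> s = exp (- \<kappa> * s) * M p s" for s
  have "M p s \<le> exp (\<kappa> * s) * \<phi> t" if "s \<ge> t" for s
  proof -
    have "\<phi> s \<le> \<phi> t"
    proof (rule DERIV_nonpos_imp_nonincreasing[OF that])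
      fix x
      have "(\<phi> has_real_derivative - (exp (- \<kappa> * x) * M ([:\<kappa>, -1:] * p) x)) (at x)"
        unfolding \<phi>_def[abs_def] linear_factor
        by (auto intro!: derivative_eq_intros deriv simp: algebra_simps)
      then show "\<exists>D. (\<phi> has_real_derivative D) (at x) \<and> D \<le> 0"
        using nonneg[of x] by (intro exI conjI) auto
    qed
    then have "exp (\<kappa> * s) * \<phi> s \<le> exp (\<kappa> * s) * \<phi> t" by (intro mult_left_mono) auto
    then show ?thesis by (simp add: \<phi>_def mult.assoc[symmetric] exp_add[symmetric])
  qed
  then have "\<forall>\<^sub>F s in at_top. (-1) * M p s \<ge> (- \<phi> t) * exp (\<kappa> * s)"
    unfolding eventually_at_top_linorder by (intro exI[of _ t]) (simp add: mult.commute)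
  moreover have "- \<phi> t > 0" using neg by (simp add: \<phi>_def mult_less_0_iff)
  ultimately have "grows \<kappa> (M p)" unfolding grows_def by blast
  with assms(2) show False by simp
qed

text \<open>Here \<open>exp (\<mu> t) M p\<close> is nondecreasing, and it tends to 0 at minus
  infinity because \<open>M p\<close> has a finite limit there.\<close>

lemma nonneg_if_bounded_at_bot:
  assumes nonneg: "\<And>t. M ([:\<mu>, 1:] * p) t \<ge> 0" and "\<mu> > 0" and lim: "(M p \<longlongrightarrow> l) at_bot"
  shows "M p t \<ge> 0"
proof -
  define \<phi> where "\<phi> s = exp (\<mu> * s) * M p s" for s
  have "\<phi> s \<le> \<phi> t" if "s \<le> t" for s
  proof (rule DERIV_nonneg_imp_nondecreasing[OF that])
    fix x
    have "(\<phi> has_real_derivative exp (\<mu> * x) * M ([:\<mu>, 1:] * p) x) (at x)"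
      unfolding \<phi>_def[abs_def] linear_factor
      by (auto intro!: derivative_eq_intros deriv simp: algebra_simps)
    moreover have "0 \<le> exp (\<mu> * x) * M ([:\<mu>, 1:] * p) x" using nonneg by simp
    ultimately show "\<exists>D. (\<phi> has_real_derivative D) (at x) \<and> 0 \<le> D" by blast
  qed
  then have "\<forall>\<^sub>F s in at_bot. \<phi> s \<le> \<phi> t" unfolding eventually_at_bot_linorder by blast
  moreover have "(\<phi> \<longlongrightarrow> 0 * l) at_bot"
    unfolding \<phi>_def[abs_def]
    by (intro tendsto_mult lim filterlim_compose[OF exp_at_bot])
      (use \<open>\<mu> > 0\<close> in \<open>intro filterlim_tendsto_pos_mult_at_bot[OF tendsto_const] filterlim_ident; simp\<close>)
  ultimately have "0 \<le> \<phi> t" using tendsto_upperbound by fastforce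
  then show ?thesis by (simp add: \<phi>_def zero_le_mult_iff)
qed

text \<open>The largest characteristic root is removed first: its failure would make \<open>M 1\<close> grow
  exponentially at a rate which no other root can cancel.\<close>

lemma maximum_principle:
  assumes nonneg: "\<And>t. M (\<Prod>j=1..N. [:4 * (real j)\<^sup>2, 0, -1:]) t \<ge> 0"
    and lim: "\<And>p. (M p \<longlongrightarrow> poly p 0) at_bot"
    and not_grows: "\<And>\<kappa>. \<kappa> > 0 \<Longrightarrow> \<not> grows \<kappa> (M 1)"
  shows "M 1 t \<ge> 0"
proof -
  \<comment> \<open>\<open>4 j^2 - X^2\<close> splits into \<open>2 j - X\<close> and
    \<open>2 j + X\<close>: \<open>A\<close> collects the positive roots, \<open>B\<close> the
    negative ones.\<close>
  define A B :: "nat \<Rightarrow> real poly"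
    where "A k = (\<Prod>j=1..k. [:2 * real j, -1:])" and "B k = (\<Prod>j=1..k. [:2 * real j, 1:])" for k
  have A_Suc: "A (Suc k) = [:2 * real (Suc k), -1:] * A k"
    and B_Suc: "B (Suc k) = [:2 * real (Suc k), 1:] * B k" for k
    unfolding A_def B_def by (simp_all add: prod.nat_ivl_Suc' del: mult_pCons_left mult_pCons_right)
  have "(\<Prod>j=1..N. [:4 * (real j)\<^sup>2, 0, -1:]) = A N * B N"
    unfolding A_def B_def prod.distrib[symmetric]
    by (rule prod.cong) (simp_all add: power2_eq_square)
  then have top: "M (A N * B N) t \<ge> 0" for t using nonneg by simp
  \<comment> \<open>Strips the factors of \<open>A\<close>, largest root first. Once
    \<open>i >= N\<close>, truncated subtraction makes both indices 0 and the claim repeats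
    itself.\<close>
  have "M (A (N - i) * B N) t \<ge> 0" for i t
  proof (induction i arbitrary: t)
    case 0
    then show ?case using top by simp
  next
    case (Suc i)
    show ?case
    proof (cases "i < N")
      case True
      define k where "k = N - Suc i"
      have k: "N - i = Suc k" using True by (simp add: k_def)
      have "M ([:2 * real (Suc k), -1:] * (A k * B N)) s \<ge> 0" for s
        using Suc.IH[of s] unfolding k A_Suc by (simp only: mult.assoc)
      moreover have "\<not> grows (2 * real (Suc k)) (M (A k * B N))"
      proof
        assume "grows (2 * real (Suc k)) (M (A k * B N))"
        then have "grows (2 * real (Suc k)) (M (B N))"
          unfolding A_def by (rule grows_prod_minus) simp
        then have "grows (2 * real (Suc k)) (M (B N * 1))" by simp
        then have "grows (2 * real (Suc k)) (M 1)"
          unfolding B_def by (rule grows_prod_plus) simp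
        then show False using not_grows by simp
      qed
      ultimately show ?thesis unfolding k_def[symmetric] by (rule nonneg_if_not_grows)
    next
      case False
      then show ?thesis using Suc.IH by simp
    qed
  qed
  from this[of N] have B_N: "M (B N) t \<ge> 0" for t by (simp add: A_def)
  \<comment> \<open>The factors of \<open>B\<close> are stripped by means of the finite limits at
    minus infinity.\<close>
  have "M (B (N - i)) t \<ge> 0" for i t
  proof (induction i arbitrary: t)
    case 0
    then show ?case using B_N by simp
  next
    case (Suc i)
    show ?case
    proof (cases "i < N")
      case True
      define k where "k = N - Suc i"
      have k: "N - i = Suc k" using True by (simp add: k_def)
      have "M ([:2 * real (Suc k), 1:] * B k) s \<ge> 0" for s
        using Suc.IH[of s] unfolding k B_Suc .
      then show ?thesis unfolding k_def[symmetric]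
        by (rule nonneg_if_bounded_at_bot) (use lim in auto)
    next
      case False
      then show ?thesis using Suc.IH by simp
    qed
  qed
  from this[of N] show ?thesis by (simp add: B_def)
qed

end

section \<open>Radial means\<close>

text \<open>\<open>g\<close> is a function of the squared norm, so the bounds 1 and 4 describe the
  shell of radii 1 to 2. Averages over shells stand in for averages over spheres, so that Lebesgue
  integrals and the divergence theorem suffice.\<close>

locale radial_bump =
  fixes g g' :: "real \<Rightarrow> real"
  assumes g': "\<And>s. (g has_real_derivative g' s) (at s)"
    and cont_g': "continuous_on UNIV g'"
    and nonneg: "\<And>s. g s \<ge> 0"
    and inner_supp: "\<And>s. s \<le> 1 \<Longrightarrow> g s = 0"
    and outer_supp: "\<And>s. s \<ge> 4 \<Longrightarrow> g s = 0"
    and normalized: "(\<integral>x. g ((x::'a::euclidean_space) \<bullet> x) \<partial>lborel) = 1"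
begin

lemma outer_supp': "s > 4 \<Longrightarrow> g s = 0"
  using outer_supp by simp

text \<open>Substituting \<open>x = exp t * y\<close> turns this into the integral of
  \<open>g (y \<bullet> y) \<psi> (exp t * y)\<close> over \<open>y\<close>; the prefactor is the
  Jacobian.\<close>

definition mean :: "('a \<Rightarrow> real) \<Rightarrow> real \<Rightarrow> real" where
  "mean \<psi> t = exp (- real DIM('a) * t) * (\<integral>x. g ((x \<bullet> x) * exp (- 2 * t)) * \<psi> x \<partial>lborel)"

lemma integrable_weighted:
  "continuous_on UNIV \<psi> \<Longrightarrow> integrable lborel (\<lambda>x::'a. g ((x \<bullet> x) * exp (- 2 * t)) * \<psi> x)"
  by (rule integrable_dilated(1)[OF g' cont_g' outer_supp'])

lemma mean_add:
  assumes "continuous_on UNIV \<phi>" "continuous_on UNIV \<psi>"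
  shows "mean (\<lambda>x. \<phi> x + \<psi> x) t = mean \<phi> t + mean \<psi> t"
  using integrable_weighted[OF assms(1), of t] integrable_weighted[OF assms(2), of t]
  by (simp add: mean_def algebra_simps)

lemma mean_cmult: "mean (\<lambda>x. c * \<psi> x) t = c * mean \<psi> t"
  by (simp add: mean_def mult.left_commute[of _ c])

text \<open>Only values inside the open shell count. This locality makes conditions that hold just
  near infinity, or just near the origin, usable.\<close>

lemma mean_mono:
  assumes "continuous_on UNIV \<phi>" "continuous_on UNIV \<psi>"
    and le: "\<And>x. exp t < norm x \<Longrightarrow> norm x < 2 * exp t \<Longrightarrow> \<phi> x \<le> \<psi> x"
  shows "mean \<phi> t \<le> mean \<psi> t"
  unfolding mean_def
proof (rule mult_left_mono, rule integral_mono)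
  fix x :: 'a
  let ?s = "(x \<bullet> x) * exp (- 2 * t)"
  have s: "?s = (norm x / exp t)\<^sup>2"
  proof -
    have "exp (- 2 * t) = inverse ((exp t)\<^sup>2)"
      by (simp add: exp_minus power2_eq_square exp_add[symmetric])
    then show ?thesis by (simp add: divide_inverse power_mult_distrib power2_norm_eq_inner power_inverse)
  qed
  show "g ?s * \<phi> x \<le> g ?s * \<psi> x"
  proof (cases "1 < ?s \<and> ?s < 4")
    case True
    then have "1\<^sup>2 < (norm x / exp t)\<^sup>2" "(norm x / exp t)\<^sup>2 < 2\<^sup>2" unfolding s by auto
    then have "1 < norm x / exp t" "norm x / exp t < 2"
      using power_less_imp_less_base[of 1 2 "norm x / exp t"]
        power_less_imp_less_base[of "norm x / exp t" 2 2] by auto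
    then show ?thesis using le[of x] nonneg by (intro mult_left_mono) (auto simp: field_simps)
  next
    case False
    then have "g ?s = 0" using inner_supp outer_supp by force
    then show ?thesis by simp
  qed
qed (use integrable_weighted assms(1,2) in auto)

lemma mean_cong:
  assumes "\<And>x. \<phi> x = \<psi> x"
  shows "mean \<phi> t = mean \<psi> t"
  by (simp add: mean_def assms)

lemma DERIV_dilated:
  "((\<lambda>s. g (s * exp (- 2 * t))) has_real_derivative g' (s * exp (- 2 * t)) * exp (- 2 * t)) (at s)"
  by (rule DERIV_chain2[OF g']) (auto intro!: derivative_eq_intros)

lemma continuous_dilated: "continuous_on UNIV (\<lambda>s. g (s * c))" "continuous_on UNIV (\<lambda>s. g' (s * c))"
  by (rule continuous_on_compose2[OF has_real_derivative_continuous[OF g']]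
      continuous_on_compose2[OF cont_g'], (auto intro!: continuous_intros)[2])+

lemma dilated_supp:
  assumes "s > 4 * exp (2 * t)"
  shows "g (s * exp (- 2 * t)) = 0"
proof (rule outer_supp)
  have "4 = 4 * exp (2 * t) * exp (- 2 * t)" by (simp add: mult.assoc exp_add[symmetric])
  also have "\<dots> \<le> s * exp (- 2 * t)" using assms by (intro mult_right_mono) auto
  finally show "4 \<le> s * exp (- 2 * t)" .
qed

text \<open>The derivative in \<open>t\<close> falls on the prefactor and on the dilated weight.
  \<open>integral_radial_euler\<close> moves it over to \<open>\<psi>\<close>.\<close>

lemma has_derivative_mean:
  assumes \<psi>: "smooth \<psi>"
  shows "(mean \<psi> has_real_derivative mean (euler \<psi>) t) (at t)"
proof -
  let ?n = "real DIM('a)" and ?s = "\<lambda>x::'a. (x \<bullet> x) * exp (- 2 * t)"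
  let ?I = "\<integral>x. g (?s x) * \<psi> x \<partial>lborel" and ?J = "\<integral>x. - 2 * ?s x * g' (?s x) * \<psi> x \<partial>lborel"
  have c: "continuous_on UNIV \<psi>" by (rule smooth_continuous[OF \<psi>])
  have "((\<lambda>t. exp (- ?n * t)) has_real_derivative - ?n * exp (- ?n * t)) (at t)"
    by (auto intro!: derivative_eq_intros)
  from DERIV_mult[OF this has_derivative_dilated_integral[OF g' cont_g' outer_supp' c]]
  have D: "(mean \<psi> has_real_derivative - ?n * exp (- ?n * t) * ?I + ?J * exp (- ?n * t)) (at t)"
    unfolding mean_def[abs_def] by simp
  have IJ: "?n * ?I - ?J = - (\<integral>x. g (?s x) * euler \<psi> x \<partial>lborel)"
  proof -
    have cs: "continuous_on UNIV (\<lambda>x. - 2 * ?s x * \<psi> x)" by (intro continuous_intros c)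
    have "integrable lborel (\<lambda>x. - 2 * ?s x * g' (?s x) * \<psi> x)"
      using integrable_dilated(2)[OF g' cont_g' outer_supp' cs] by (simp add: mult_ac)
    then have "?n * ?I - ?J = (\<integral>x. ?n * (g (?s x) * \<psi> x) - (- 2 * ?s x * g' (?s x) * \<psi> x) \<partial>lborel)"
      using integrable_weighted[OF c, of t] by simp
    also have "\<dots> = (\<integral>x. (?n * g (?s x) + 2 * (x \<bullet> x) * (g' (?s x) * exp (- 2 * t))) * \<psi> x \<partial>lborel)"
      by (rule Bochner_Integration.integral_cong) (simp_all add: algebra_simps)
    also have "\<dots> = - (\<integral>x. g (?s x) * euler \<psi> x \<partial>lborel)"
      by (rule integral_radial_euler[OF DERIV_dilated _ dilated_supp \<psi>])
        (auto intro!: continuous_intros continuous_dilated)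
    finally show ?thesis .
  qed
  have "- n * e * i + j * e = - (e * (n * i - j))" for n e i j :: real
    by (simp add: algebra_simps)
  then have "- ?n * exp (- ?n * t) * ?I + ?J * exp (- ?n * t) = - (exp (- ?n * t) * (?n * ?I - ?J))" .
  also have "\<dots> = mean (euler \<psi>) t" unfolding IJ mean_def by simp
  finally show ?thesis using D by simp
qed

text \<open>The derivative in \<open>t\<close> is the mean of \<open>euler\<close> of a constant,
  hence 0, and at \<open>t = 0\<close> the value is fixed by \<open>normalized\<close>.\<close>

lemma mean_const: "mean (\<lambda>x. c) t = c"
proof -
  have "((mean (\<lambda>x. c)) has_real_derivative 0) (at s)" for s
  proof -
    have "mean (euler (\<lambda>x. c)) s = 0" by (simp only: mean_def euler_const) simp
    then show ?thesis using has_derivative_mean[OF smooth_const, of c s] by simp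
  qed
  then have "mean (\<lambda>x. c) t = mean (\<lambda>x. c) 0"
    by (intro DERIV_isconst_all allI)
  also have "\<dots> = c" using normalized by (simp add: mean_def)
  finally show ?thesis .
qed

lemma mean_at_bot:
  assumes c: "continuous_on UNIV \<psi>"
  shows "(mean \<psi> \<longlongrightarrow> \<psi> 0) at_bot"
proof (rule tendstoI)
  fix e :: real assume "e > 0"
  obtain d where "d > 0" and d: "\<And>x. norm x < d \<Longrightarrow> \<bar>\<psi> x - \<psi> 0\<bar> < e / 2"
    using c \<open>e > 0\<close> unfolding continuous_on_iff
    by (metis UNIV_I dist_norm diff_zero half_gt_zero real_norm_def)
  have "\<forall>\<^sub>F t in at_bot. t \<le> ln (d / 2)" by (rule eventually_le_at_bot)
  then show "\<forall>\<^sub>F t in at_bot. dist (mean \<psi> t) (\<psi> 0) < e"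
  proof eventually_elim
    fix t assume "t \<le> ln (d / 2)"
    then have "exp t \<le> d / 2" using \<open>d > 0\<close> by (metis exp_le_cancel_iff exp_ln half_gt_zero)
    then have "\<bar>\<psi> x - \<psi> 0\<bar> < e / 2" if "norm x < 2 * exp t" for x
      using d[of x] that by simp
    then have "\<psi> x \<le> \<psi> 0 + e / 2" "\<psi> 0 - e / 2 \<le> \<psi> x" if "norm x < 2 * exp t" for x
      using that unfolding abs_less_iff by (smt (verit))+
    then have "mean \<psi> t \<le> mean (\<lambda>x. \<psi> 0 + e / 2) t" "mean (\<lambda>x. \<psi> 0 - e / 2) t \<le> mean \<psi> t"
      by (auto intro!: mean_mono c continuous_intros)
    then show "dist (mean \<psi> t) (\<psi> 0) < e" using \<open>e > 0\<close> by (simp add: mean_const dist_real_def)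
  qed
qed

text \<open>The power \<open>(x \<bullet> x) ^ k\<close> is absorbed into the radial weight, so that
  \<open>integral_radial_laplacian\<close> applies.\<close>

lemma mean_neg_laplacian:
  assumes \<psi>: "smooth \<psi>"
  shows "mean (\<lambda>x. (x \<bullet> x) ^ Suc k * neg_laplacian \<psi> x) t
    = - mean (\<lambda>x. (x \<bullet> x) ^ k * (euler (euler \<psi>) x + (real DIM('a) - 2) * euler \<psi> x)) t"
proof -
  let ?G = "\<lambda>s. g (s * exp (- 2 * t)) * s ^ k" and ?n = "real DIM('a)"
  let ?G' = "\<lambda>s. g (s * exp (- 2 * t)) * (real k * s ^ (k - 1)) + g' (s * exp (- 2 * t)) * exp (- 2 * t) * s ^ k"
  let ?A = "\<lambda>x. (x \<bullet> x) ^ Suc k * neg_laplacian \<psi> x"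
  let ?B = "\<lambda>x. (x \<bullet> x) ^ k * (euler (euler \<psi>) x + (?n - 2) * euler \<psi> x)"
  have "(?G has_real_derivative ?G' s) (at s)" for s
    using DERIV_mult[OF DERIV_dilated[of t s] DERIV_pow[of k s]] by (simp add: mult_ac add.commute)
  moreover have "continuous_on UNIV ?G'" by (intro continuous_intros continuous_dilated)
  moreover have "?G s = 0" if "s > 4 * exp (2 * t)" for s using dilated_supp[OF that] by simp
  ultimately
  have "(\<integral>x. ?G (x \<bullet> x) * ((x \<bullet> x) * neg_laplacian \<psi> x + euler (euler \<psi>) x + (?n - 2) * euler \<psi> x) \<partial>lborel) = 0"
    by (rule integral_radial_laplacian[OF _ _ _ \<psi>])
  then have "mean (\<lambda>x. ?A x + ?B x) t = 0"
    unfolding mean_def by (simp add: algebra_simps)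
  moreover have "mean (\<lambda>x. ?A x + ?B x) t = mean ?A t + mean ?B t"
    using \<psi> by (intro mean_add smooth_continuous smooth_mult smooth_add smooth_power smooth_norm_square
        smooth_neg_laplacian smooth_euler smooth_const)
  ultimately show ?thesis by simp
qed

text \<open>Jensen's inequality: average the tangent line of \<open>exp\<close> at
  \<open>mean u t\<close>.\<close>

lemma mean_exp_ge:
  assumes c: "continuous_on UNIV u"
  shows "mean (\<lambda>x. exp (u x)) t \<ge> exp (mean u t)"
proof -
  let ?a = "mean u t"
  have "mean (\<lambda>x. exp ?a * (1 - ?a) + exp ?a * u x) t \<le> mean (\<lambda>x. exp (u x)) t"
  proof (rule mean_mono)
    fix x
    have "exp ?a * (1 + (u x - ?a)) \<le> exp ?a * exp (u x - ?a)"
      by (intro mult_left_mono exp_ge_add_one_self) auto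
    then show "exp ?a * (1 - ?a) + exp ?a * u x \<le> exp (u x)"
      by (simp add: algebra_simps flip: exp_add)
  qed (intro continuous_intros c)+
  moreover have "mean (\<lambda>x. exp ?a * (1 - ?a) + exp ?a * u x) t = exp ?a"
    by (subst mean_add, (intro continuous_intros c)+, unfold mean_const mean_cmult)
      (simp add: algebra_simps)
  ultimately show ?thesis by simp
qed

text \<open>Average \<open>(u - a)^2 >= 0\<close> with \<open>a = mean u t\<close>.\<close>

lemma mean_square_ge:
  assumes c: "continuous_on UNIV u"
  shows "mean (\<lambda>x. (u x)\<^sup>2) t \<ge> (mean u t)\<^sup>2"
proof -
  let ?a = "mean u t"
  have "mean (\<lambda>x. - ?a\<^sup>2 + 2 * ?a * u x) t \<le> mean (\<lambda>x. (u x)\<^sup>2) t"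
  proof (rule mean_mono)
    fix x
    have "0 \<le> (u x - ?a)\<^sup>2" by simp
    then show "- ?a\<^sup>2 + 2 * ?a * u x \<le> (u x)\<^sup>2" by (simp add: power2_eq_square algebra_simps)
  qed (intro continuous_intros c)+
  moreover have "mean (\<lambda>x. - ?a\<^sup>2 + 2 * ?a * u x) t = ?a\<^sup>2"
    by (subst mean_add, (intro continuous_intros c)+, unfold mean_const mean_cmult)
      (simp add: power2_eq_square)
  ultimately show ?thesis by simp
qed

text \<open>The mean of \<open>p(E) u\<close> with \<open>E\<close> the Euler operator. By
  \<open>has_derivative_mean\<close> it equals \<open>p(d/dt)\<close> applied to the mean of
  \<open>u\<close>, which makes it a \<open>shift_functional\<close>.\<close>

definition euler_poly_mean :: "('a \<Rightarrow> real) \<Rightarrow> real poly \<Rightarrow> real \<Rightarrow> real" where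
  "euler_poly_mean u p t = (\<Sum>i\<le>degree p. coeff p i * mean ((euler ^^ i) u) t)"

lemma euler_poly_mean_eq_sum:
  assumes "degree p \<le> N"
  shows "euler_poly_mean u p t = (\<Sum>i\<le>N. coeff p i * mean ((euler ^^ i) u) t)"
  unfolding euler_poly_mean_def using assms
  by (intro sum.mono_neutral_left) (auto simp: coeff_eq_0 not_le)

lemma euler_poly_mean_pCons:
  "euler_poly_mean u (pCons 0 p) t = (\<Sum>i\<le>degree p. coeff p i * mean ((euler ^^ Suc i) u) t)"
  by (subst euler_poly_mean_eq_sum[OF degree_pCons_le])
    (simp add: sum.atMost_Suc_shift del: sum.atMost_Suc)

lemma euler_poly_mean_1: "euler_poly_mean u 1 t = mean u t"
  by (simp add: euler_poly_mean_def)

lemma shift_functional_euler_poly_mean: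
  assumes "smooth u"
  shows "shift_functional (euler_poly_mean u)"
proof
  fix p q :: "real poly" and c t
  let ?N = "max (degree p) (degree q)"
  show "euler_poly_mean u (p + q) t = euler_poly_mean u p t + euler_poly_mean u q t"
    using euler_poly_mean_eq_sum[of p ?N u t] euler_poly_mean_eq_sum[of q ?N u t]
      euler_poly_mean_eq_sum[of "p + q" ?N u t] degree_add_le_max[of p q]
    by (simp add: algebra_simps sum.distrib)
  show "euler_poly_mean u (smult c p) t = c * euler_poly_mean u p t"
    using euler_poly_mean_eq_sum[OF degree_smult_le[of c p], of u t]
    by (simp add: euler_poly_mean_def sum_distrib_left mult.assoc)
  show "(euler_poly_mean u p has_real_derivative euler_poly_mean u (pCons 0 p) t) (at t)"
    unfolding euler_poly_mean_pCons unfolding euler_poly_mean_def[abs_def]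
    by (intro DERIV_sum DERIV_cmult)
      (simp add: has_derivative_mean smooth_euler_funpow assms)
qed

text \<open>For radial averages, \<open>|x|\<^bsup>2k\<^esup> (-\<Delta>)\<^sup>k\<close> becomes a polynomial in \<open>d/dt\<close>, where \<open>t = log r\<close>: the
  angular part of \<open>|x|\<^sup>2 \<Delta> = E (E + n - 2) + \<Delta>\<^bsub>S\<^esub>\<close> averages out, with \<open>E\<close> the Euler operator.\<close>

lemma mean_neg_laplacian_funpow:
  assumes u: "smooth u"
  shows "mean (\<lambda>x. (x \<bullet> x) ^ k * (neg_laplacian ^^ k) u x) t =
    euler_poly_mean u (\<Prod>i<k. - ([:- 2 * real i, 1:] * [:real DIM('a) - 2 - 2 * real i, 1:])) t"
proof (induction k arbitrary: t)
  case 0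
  then show ?case by (simp add: euler_poly_mean_1)
next
  case (Suc k)
  interpret shift_functional "euler_poly_mean u" by (rule shift_functional_euler_poly_mean[OF u])
  let ?n = "real DIM('a)" and ?k = "real k"
  define P where "P = (\<Prod>i<k. - ([:- 2 * real i, 1:] * [:?n - 2 - 2 * real i, 1:]))"
  define \<psi> where "\<psi> = (neg_laplacian ^^ k) u"
  define N where "N = (\<lambda>x. (x \<bullet> x) ^ k * \<psi> x)"
  have \<psi>: "smooth \<psi>" unfolding \<psi>_def by (rule smooth_neg_laplacian_funpow[OF u])
  have N: "smooth N" unfolding N_def by (intro smooth_mult smooth_power smooth_norm_square \<psi>)
  have EN: "euler N = (\<lambda>x. (x \<bullet> x) ^ k * (euler \<psi> x + 2 * ?k * \<psi> x))"
    unfolding N_def by (rule ext) (rule euler_norm_power_mult[OF \<psi>])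
  have sm: "smooth (\<lambda>x. euler \<psi> x + 2 * ?k * \<psi> x)"
    by (intro smooth_add smooth_mult smooth_const smooth_euler \<psi>)
  have EEN: "euler (euler N) x = (x \<bullet> x) ^ k * (euler (euler \<psi>) x + 4 * ?k * euler \<psi> x + 4 * ?k\<^sup>2 * \<psi> x)" for x
  proof -
    have "euler (\<lambda>x. 2 * ?k * \<psi> x) x = 2 * ?k * euler \<psi> x" for x
      using euler_mult[OF smooth_const \<psi>] by (simp add: euler_const)
    then have "euler (\<lambda>x. euler \<psi> x + 2 * ?k * \<psi> x) x = euler (euler \<psi>) x + 2 * ?k * euler \<psi> x"
      using euler_add[OF smooth_euler[OF \<psi>] smooth_mult[OF smooth_const \<psi>]] by simp
    then show ?thesis unfolding EN euler_norm_power_mult[OF sm]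
      by (simp add: power2_eq_square algebra_simps)
  qed
  have mN: "mean N = euler_poly_mean u P"
    using Suc.IH unfolding N_def \<psi>_def P_def by (intro ext) simp
  \<comment> \<open>The means of \<open>euler N\<close> and \<open>euler (euler N)\<close> come from
    differentiating the induction hypothesis, by uniqueness of derivatives.\<close>
  have mEN: "mean (euler N) = euler_poly_mean u (pCons 0 P)"
    using has_derivative_mean[OF N] deriv[of P] unfolding mN by (intro ext) (rule DERIV_unique)
  have mEEN: "mean (euler (euler N)) = euler_poly_mean u (pCons 0 (pCons 0 P))"
    using has_derivative_mean[OF smooth_euler[OF N]] deriv[of "pCons 0 P"] unfolding mEN
    by (intro ext) (rule DERIV_unique)
  \<comment> \<open>In terms of \<open>N = |x|^(2 k) \<psi>\<close> the Euler operator on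
    \<open>\<psi>\<close> becomes \<open>E - 2 k\<close>. So \<open>E (E + n - 2)\<close> becomes
    \<open>(E - 2 k) (E + n - 2 - 2 k)\<close>, whose lower coefficients are \<open>?c\<close> and
    \<open>?d\<close>.\<close>
  let ?c = "?n - 2 - 4 * ?k" and ?d = "- 2 * ?k * (?n - 2 - 2 * ?k)"
  have "mean (\<lambda>x. (x \<bullet> x) ^ Suc k * (neg_laplacian ^^ Suc k) u x) t
      = - mean (\<lambda>x. (x \<bullet> x) ^ k * (euler (euler \<psi>) x + (?n - 2) * euler \<psi> x)) t"
    using mean_neg_laplacian[OF \<psi>, of k t] by (simp add: \<psi>_def)
  also have "mean (\<lambda>x. (x \<bullet> x) ^ k * (euler (euler \<psi>) x + (?n - 2) * euler \<psi> x)) t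
      = mean (\<lambda>x. euler (euler N) x + (?c * euler N x + ?d * N x)) t"
    by (rule mean_cong, unfold EEN, unfold EN, unfold N_def) (simp add: power2_eq_square algebra_simps)
  also have "\<dots> = mean (euler (euler N)) t + (?c * mean (euler N) t + ?d * mean N t)"
    by (subst mean_add mean_cmult,
      (intro smooth_continuous smooth_euler smooth_add smooth_mult smooth_const N)+)+
      (simp only: mean_cmult)
  also have "- \<dots> = euler_poly_mean u (- ([:- 2 * ?k, 1:] * [:?n - 2 - 2 * ?k, 1:]) * P) t"
  proof -
    have "- ([:- 2 * ?k, 1:] * [:?n - 2 - 2 * ?k, 1:]) * P
        = smult (-1) (pCons 0 (pCons 0 P)) + (smult (- ?c) (pCons 0 P) + smult (- ?d) P)"
      by (simp add: algebra_simps)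
    then have "euler_poly_mean u (- ([:- 2 * ?k, 1:] * [:?n - 2 - 2 * ?k, 1:]) * P) t
        = -1 * mean (euler (euler N)) t + (- ?c * mean (euler N) t + - ?d * mean N t)"
      unfolding mN mEN mEEN by (simp only: add smult)
    also have "\<dots> = - (mean (euler (euler N)) t + (?c * mean (euler N) t + ?d * mean N t))"
      by (simp only: minus_add_distrib mult_minus1 mult_minus_left)
    finally show ?thesis by simp
  qed
  finally show ?case unfolding P_def by (simp only: prod.lessThan_Suc mult.commute)
qed

end

section \<open>Existence of a radial bump, and the characteristic polynomial in dimension
  \<open>2 m\<close>\<close>

lemma DERIV_max_0_square: "((\<lambda>s. (max 0 s)\<^sup>2) has_real_derivative 2 * max 0 s) (at (s::real))"
proof -
  consider "s > 0" | "s < 0" | "s = 0" by linarith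
  then show ?thesis
  proof cases
    case 1
    have "((\<lambda>s. s\<^sup>2) has_real_derivative 2 * s) (at s)" by (auto intro!: derivative_eq_intros)
    then have "((\<lambda>s. (max 0 s)\<^sup>2) has_real_derivative 2 * s) (at s)"
      by (rule has_field_derivative_transform_within_open[of _ _ _ "{0<..}"]) (use 1 in auto)
    with 1 show ?thesis by simp
  next
    case 2
    have "((\<lambda>s. (max 0 s)\<^sup>2) has_real_derivative 0) (at s)"
      by (rule has_field_derivative_transform_within_open[of "\<lambda>s. 0" _ _ "{..<0}"]) (use 2 in auto)
    with 2 show ?thesis by simp
  next
    case 3
    have "((\<lambda>h::real. (max 0 h)\<^sup>2 / h) \<longlongrightarrow> 0) (at 0)"
    proof (rule Lim_null_comparison)
      show "\<forall>\<^sub>F h::real in at 0. norm ((max 0 h)\<^sup>2 / h) \<le> \<bar>h\<bar>"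
        by (rule always_eventually) (auto simp: max_def power2_eq_square)
    qed (auto intro!: tendsto_eq_intros)
    with 3 show ?thesis by (simp add: DERIV_def)
  qed
qed

lemma ex_radial_bump: "\<exists>g g'. radial_bump TYPE('a::euclidean_space) g g'"
proof -
  \<comment> \<open>The polynomial is positive exactly on the interval from 1 to 4, and squaring its
    positive part gives a C^1 function.\<close>
  define g where "g s = (max 0 ((s - 1) * (4 - s)))\<^sup>2" for s :: real
  define g' where "g' s = 2 * max 0 ((s - 1) * (4 - s)) * (5 - 2 * s)" for s :: real
  have g': "(g has_real_derivative g' s) (at s)" for s
  proof -
    have "((\<lambda>s. (s - 1) * (4 - s)) has_real_derivative 5 - 2 * s) (at s)"
      by (auto intro!: derivative_eq_intros simp: algebra_simps)
    from DERIV_chain2[OF DERIV_max_0_square this] show ?thesis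
      by (simp add: g_def[abs_def] g'_def)
  qed
  have cont_g': "continuous_on UNIV g'"
    unfolding g'_def[abs_def] by (intro continuous_intros)
  have supp: "g s = 0" if "s \<le> 1 \<or> s \<ge> 4" for s
  proof -
    have "(s - 1) * (4 - s) \<le> 0" using that by (auto simp: mult_le_0_iff)
    then show ?thesis by (simp add: g_def)
  qed
  have cont: "continuous_on UNIV (\<lambda>x::'a. g (x \<bullet> x))"
    by (rule continuous_on_radial(1)[OF g' cont_g', of 4]) (simp add: supp)
  have int: "integrable lborel (\<lambda>x::'a. g (x \<bullet> x))"
  proof (rule integrable_compact_support[OF cont])
    fix x :: 'a assume "norm x > 5"
    then have "x \<bullet> x > 4" using norm_square_gt[of 4 x] by simp
    then show "g (x \<bullet> x) = 0" by (simp add: supp)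
  qed
  define c where "c = (\<integral>x. g ((x::'a) \<bullet> x) \<partial>lborel)"
  have "c \<ge> 0" unfolding c_def by (intro integral_nonneg_AE) (auto simp: g_def)
  \<comment> \<open>Otherwise the continuous function \<open>g (x \<bullet> x)\<close> would vanish
    almost everywhere, whereas it is nonzero on an open set containing a point of norm
    \<open>sqrt 2\<close>.\<close>
  moreover have "c \<noteq> 0"
  proof
    define S where "S = (\<lambda>x::'a. g (x \<bullet> x)) -` (- {0})"
    assume "c = 0"
    then have "AE x in lborel. g ((x::'a) \<bullet> x) = 0"
      unfolding c_def using int by (subst (asm) integral_nonneg_eq_0_iff_AE) (auto simp: g_def)
    moreover have "open S"
      unfolding S_def by (rule open_vimage[OF _ cont]) (simp add: open_Compl)
    ultimately have "S \<in> null_sets lborel"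
      by (subst AE_iff_null_sets) (auto simp: S_def borel_open)
    then have "negligible S"
      using negligible_iff_null_sets null_sets_completionI by blast
    moreover have "sqrt 2 *\<^sub>R (SOME b. b \<in> Basis) \<in> S"
      by (simp add: S_def g_def SOME_Basis)
    ultimately show False using open_not_negligible[OF \<open>open S\<close>] by blast
  qed
  ultimately have "c > 0" by simp
  have "radial_bump TYPE('a) (\<lambda>s. g s / c) (\<lambda>s. g' s / c)"
  proof
    show "((\<lambda>s. g s / c) has_real_derivative g' s / c) (at s)" for s
      by (rule DERIV_cdivide[OF g'])
    show "continuous_on UNIV (\<lambda>s. g' s / c)"
      using \<open>c > 0\<close> by (intro continuous_intros cont_g') auto
    show "(\<integral>x. g ((x::'a) \<bullet> x) / c \<partial>lborel) = 1"
      using \<open>c > 0\<close> by (simp add: c_def)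
  qed (use supp \<open>c > 0\<close> in \<open>auto simp: g_def\<close>)
  then show ?thesis by blast
qed

lemma ex_antiderivative:
  fixes k :: "real \<Rightarrow> real"
  assumes "continuous_on UNIV k"
  shows "\<exists>H. \<forall>s. (H has_real_derivative k s) (at s)"
proof -
  have "isCont k x" for x using assms continuous_on_eq_continuous_at[OF open_UNIV] by blast
  then show ?thesis
    using einterval_antiderivative[of "-\<infinity>" "\<infinity>" k]
    by (auto simp: has_real_derivative_iff_has_vector_derivative)
qed

text \<open>Reversing the order of the second factors, \<open>m - 1 - i\<close> for
  \<open>i\<close>, pairs \<open>2 i - X\<close> with \<open>2 i + X\<close>. The pair with
  \<open>i = 0\<close> contributes \<open>- X^2\<close>, the two outer \<open>pCons\<close>.\<close>

lemma prod_euler_factors: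
  assumes "m > 0"
  shows "(\<Prod>i<m. - ([:- 2 * real i, 1:] * [:real (2 * m) - 2 - 2 * real i, 1:]))
    = - pCons 0 (pCons 0 (\<Prod>j=1..m - 1. [:4 * (real j)\<^sup>2, 0, -1:]))"
proof -
  have "(\<Prod>i<m. - ([:- 2 * real i, 1:] * [:real (2 * m) - 2 - 2 * real i, 1:]))
      = (\<Prod>i<m. [:2 * real i, -1:]) * (\<Prod>i<m. [:real (2 * m) - 2 - 2 * real i, 1:])"
    unfolding prod.distrib[symmetric] by (rule prod.cong) (simp_all add: algebra_simps)
  also have "(\<Prod>i<m. [:real (2 * m) - 2 - 2 * real i, 1:]) = (\<Prod>i<m. [:2 * real (m - Suc i), 1:])"
    by (rule prod.cong) (auto simp: of_nat_diff)
  also have "\<dots> = (\<Prod>i<m. [:2 * real i, 1:])"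
    by (rule prod.nat_diff_reindex[of "\<lambda>i. [:2 * real i, 1:]"])
  also have "(\<Prod>i<m. [:2 * real i, -1:]) * (\<Prod>i<m. [:2 * real i, 1:])
      = (\<Prod>i<m. [:4 * (real i)\<^sup>2, 0, -1:])"
    unfolding prod.distrib[symmetric] by (rule prod.cong) (simp_all add: power2_eq_square)
  also have "\<dots> = (\<Prod>i\<in>insert 0 {1..m - 1}. [:4 * (real i)\<^sup>2, 0, -1:])"
    using assms by (intro prod.cong) auto
  also have "\<dots> = [:0, 0, -1:] * (\<Prod>j=1..m - 1. [:4 * (real j)\<^sup>2, 0, -1:])"
    by (subst prod.insert) auto
  also have "\<dots> = - pCons 0 (pCons 0 (\<Prod>j=1..m - 1. [:4 * (real j)\<^sup>2, 0, -1:]))"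
    by simp
  finally show ?thesis .
qed

section \<open>The two conflicting bounds for the mean of \<open>euler u\<close>\<close>

context radial_bump
begin

text \<open>Dominated convergence: each fixed point is eventually inside the inner radius of the
  shell, where the weight is 0.\<close>

lemma integral_bump_at_top:
  assumes "integrable lborel w" and w: "\<And>x. w x \<ge> 0" and wm: "w \<in> borel_measurable borel"
  shows "((\<lambda>t. \<integral>x. g ((x \<bullet> x) * exp (- 2 * t)) * w x \<partial>(lborel :: 'a measure)) \<longlongrightarrow> 0) at_top"
proof -
  have contg: "continuous_on UNIV g" by (rule has_real_derivative_continuous[OF g'])
  have "bounded (g ` {1..4})"
    by (intro compact_imp_bounded compact_continuous_image continuous_on_subset[OF contg]) auto
  then obtain B where "\<forall>s\<in>{1..4}. \<bar>g s\<bar> \<le> B"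
    unfolding bounded_iff by auto
  then have B: "\<And>s. s \<in> {1..4} \<Longrightarrow> g s \<le> B"
    using abs_le_D1 by blast
  have gB: "g s \<le> max 0 B" for s
    using B[of s] inner_supp[of s] outer_supp[of s] by (cases "s \<in> {1..4}") (auto simp: le_max_iff_disj)
  have "((\<lambda>t. \<integral>x. g ((x \<bullet> x) * exp (- 2 * t)) * w x \<partial>(lborel :: 'a measure))
      \<longlongrightarrow> (\<integral>x. 0 \<partial>(lborel :: 'a measure))) at_top"
  proof (rule integral_dominated_convergence_at_top[where w = "\<lambda>x. max 0 B * w x"])
    show "(\<lambda>x. g ((x \<bullet> x) * exp (- 2 * t)) * w x) \<in> borel_measurable lborel" for t
      using wm borel_measurable_continuous_onI[OF contg] by measurable
    show "integrable lborel (\<lambda>x. max 0 B * w x)" using assms(1) by simp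
    show "\<forall>\<^sub>F t in at_top. AE x in lborel. norm (g ((x \<bullet> x) * exp (- 2 * t)) * w x) \<le> max 0 B * w x"
      using gB nonneg w by (auto intro!: always_eventually AE_I2 mult_right_mono simp: abs_mult)
    show "AE x in lborel. ((\<lambda>t. g ((x \<bullet> x) * exp (- 2 * t)) * w x) \<longlongrightarrow> 0) at_top"
    proof (rule AE_I2)
      fix x :: 'a
      have "((\<lambda>t. (x \<bullet> x) * exp (- 2 * t)) \<longlongrightarrow> (x \<bullet> x) * 0) at_top"
        by (intro tendsto_mult tendsto_const filterlim_compose[OF exp_at_bot]
            filterlim_tendsto_neg_mult_at_bot[OF tendsto_const] filterlim_ident) auto
      then have "\<forall>\<^sub>F t in at_top. (x \<bullet> x) * exp (- 2 * t) < 1"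
        by (rule order_tendstoD) simp
      then have "\<forall>\<^sub>F t in at_top. g ((x \<bullet> x) * exp (- 2 * t)) * w x = 0"
        by eventually_elim (simp add: inner_supp)
      then show "((\<lambda>t. g ((x \<bullet> x) * exp (- 2 * t)) * w x) \<longlongrightarrow> 0) at_top"
        by (rule tendsto_eventually)
    qed
  qed simp
  then show ?thesis by simp
qed

text \<open>\<open>h (|x|^2 exp (-2 t))\<close> is a smoothed indicator of a ball of radius
  comparable to \<open>exp t\<close>. Its derivative is chosen so that differentiating in
  \<open>t\<close> yields \<open>|x|^n\<close> times the weight of \<open>mean\<close>. The value
  \<open>h 0\<close> comes from \<open>integral_radial\<close>.\<close>

lemma ex_cutoff:
  assumes "m > 0" "DIM('a) = 2 * m"
  obtains h where "\<And>s. (h has_real_derivative - (s ^ (m - 1) * g s) / 2) (at s)"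
    and "\<And>s. s \<ge> 4 \<Longrightarrow> h s = 0" and "\<And>s. 0 \<le> h s" and "\<And>s. s \<ge> 0 \<Longrightarrow> h s \<le> h 0"
    and "real DIM('a) * unit_ball_vol (real DIM('a)) * h 0 = 1"
proof -
  let ?k = "\<lambda>s. - (s ^ (m - 1) * g s) / 2"
  have "continuous_on UNIV ?k"
    by (intro continuous_intros has_real_derivative_continuous[OF g']) auto
  then obtain H where H: "\<And>s. (H has_real_derivative ?k s) (at s)"
    using ex_antiderivative by blast
  define h where "h s = H s - H 4" for s
  have h': "(h has_real_derivative ?k s) (at s)" for s
    unfolding h_def[abs_def] using DERIV_diff[OF H DERIV_const] by simp
  have k: "?k s \<le> 0" for s
    using nonneg[of s] inner_supp[of s] by (cases "s \<le> 1") auto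
  have anti: "h b \<le> h a" if "a \<le> b" for a b
    by (rule DERIV_nonpos_imp_nonincreasing[OF that]) (use h' k in blast)
  have h4: "h s = 0" if "s \<ge> 4" for s
  proof -
    have "h 4 \<le> h s"
    proof (rule DERIV_nonneg_imp_nondecreasing[OF that])
      fix r :: real assume "4 \<le> r"
      then show "\<exists>y. (h has_real_derivative y) (at r) \<and> 0 \<le> y"
        using h'[of r] outer_supp[of r] by (intro exI[of _ 0]) simp
    qed
    with anti[OF that] show ?thesis by (simp add: h_def)
  qed
  have "0 \<le> h s" for s
    using anti[of s 4] h4[of s] h4[of 4] by (cases "s \<le> 4") auto
  moreover have "real DIM('a) * unit_ball_vol (real DIM('a)) * (h 0 - h 4) = 1"
  proof -
    have "(\<integral>x. g ((x::'a) \<bullet> x) \<partial>lborel) = real DIM('a) * unit_ball_vol (real DIM('a)) * (h 0 - h 4)"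
      by (rule integral_radial[OF g' cont_g' outer_supp' assms(2,1) _ _ h'])
        (simp_all add: outer_supp)
    then show ?thesis using normalized by (rule trans[OF sym])
  qed
  ultimately show ?thesis using h' h4 anti by (intro that[of h]) auto
qed

text \<open>Every term carries at least one Euler derivative, which vanishes at the origin.\<close>

lemma euler_poly_mean_at_bot:
  assumes "smooth u"
  shows "(euler_poly_mean u (pCons 0 p) \<longlongrightarrow> 0) at_bot"
proof -
  have "((\<lambda>t. \<Sum>i\<le>degree p. coeff p i * mean ((euler ^^ Suc i) u) t)
      \<longlongrightarrow> (\<Sum>i\<le>degree p. coeff p i * (euler ^^ Suc i) u 0)) at_bot"
    by (intro tendsto_sum tendsto_mult tendsto_const mean_at_bot smooth_continuous smooth_euler_funpow assms)
  then show ?thesis unfolding euler_poly_mean_pCons[abs_def] by (simp add: euler_at_0)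
qed

text \<open>Put \<open>z = mean (euler u)\<close>. Multiply the curvature inequality by
  \<open>|x|^2\<close> and average: the left side is at least \<open>(n-2)/2 z^2\<close>, the right
  side equals \<open>- z' - (n-2) z\<close>. This is the Riccati inequality with
  \<open>d = n - 2\<close>.\<close>

lemma mean_euler_not_grows:
  assumes u: "smooth u" and "DIM('a) \<ge> 4" and "compact K"
    and K: "\<And>x. x \<notin> K \<Longrightarrow> (real DIM('a) - 2) / 2 * (norm (gradient u x))\<^sup>2 \<le> neg_laplacian u x"
    and "\<kappa> > 0"
  shows "\<not> grows \<kappa> (\<lambda>t. mean (euler u) t + 1)"
proof -
  let ?n = "real DIM('a)"
  have c: "continuous_on UNIV (\<lambda>x. (x \<bullet> x) ^ Suc 0 * neg_laplacian u x)"
    "continuous_on UNIV (\<lambda>x. (euler u x)\<^sup>2)" "continuous_on UNIV (euler u)"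
    "continuous_on UNIV (euler (euler u))"
    by (intro smooth_continuous smooth_mult smooth_power smooth_norm_square
        smooth_neg_laplacian smooth_euler u)+
  obtain B where B: "\<And>x. x \<in> K \<Longrightarrow> norm x \<le> B"
    using compact_imp_bounded[OF \<open>compact K\<close>] unfolding bounded_iff by blast
  show ?thesis
  proof (rule riccati_not_grows)
    show "(mean (euler u) has_real_derivative mean (euler (euler u)) t) (at t)" for t
      by (rule has_derivative_mean[OF smooth_euler[OF u]])
    \<comment> \<open>From this \<open>t\<close> on the shell lies outside the ball of radius
      \<open>B\<close>, hence outside \<open>K\<close>.\<close>
    fix t assume t: "t \<ge> ln (\<bar>B\<bar> + 1)"
    have "\<bar>B\<bar> + 1 \<le> exp t" using t by (metis abs_ge_zero add_nonneg_pos exp_le_cancel_iff exp_ln zero_less_one)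
    let ?z = "mean (euler u) t"
    have "(?n - 2) / 2 * ?z\<^sup>2 \<le> (?n - 2) / 2 * mean (\<lambda>x. (euler u x)\<^sup>2) t"
      using \<open>DIM('a) \<ge> 4\<close> by (intro mult_left_mono mean_square_ge c) auto
    also have "\<dots> = mean (\<lambda>x. (?n - 2) / 2 * (euler u x)\<^sup>2) t"
      by (rule mean_cmult[symmetric])
    also have "\<dots> \<le> mean (\<lambda>x. (x \<bullet> x) ^ Suc 0 * neg_laplacian u x) t"
    proof (rule mean_mono)
      fix x :: 'a assume "exp t < norm x"
      then have "x \<notin> K" using \<open>\<bar>B\<bar> + 1 \<le> exp t\<close> B[of x] by auto
      have "(?n - 2) / 2 * (euler u x)\<^sup>2 \<le> (?n - 2) / 2 * ((x \<bullet> x) * (norm (gradient u x))\<^sup>2)"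
        using \<open>DIM('a) \<ge> 4\<close> by (intro mult_left_mono euler_square_le) auto
      also have "\<dots> = (x \<bullet> x) * ((?n - 2) / 2 * (norm (gradient u x))\<^sup>2)" by simp
      also have "\<dots> \<le> (x \<bullet> x) * neg_laplacian u x"
        by (intro mult_left_mono K \<open>x \<notin> K\<close>) simp
      finally show "(?n - 2) / 2 * (euler u x)\<^sup>2 \<le> (x \<bullet> x) ^ Suc 0 * neg_laplacian u x" by simp
    qed (intro continuous_intros c)+
    also have "\<dots> = - mean (\<lambda>x. euler (euler u) x + (?n - 2) * euler u x) t"
      using mean_neg_laplacian[OF u, of 0 t] by simp
    also have "mean (\<lambda>x. euler (euler u) x + (?n - 2) * euler u x) t
        = mean (euler (euler u)) t + (?n - 2) * ?z"
      by (subst mean_add, (intro continuous_intros c)+) (simp only: mean_cmult)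
    finally show "mean (euler (euler u)) t \<le> - (?n - 2) * (?z * (1 + ?z / 2))"
      by (simp add: power2_eq_square field_simps)
  qed (use \<open>DIM('a) \<ge> 4\<close> \<open>\<kappa> > 0\<close> in auto)
qed

text \<open>The bound on \<open>f\<close> makes the mass \<open>F\<close> of \<open>f\<close> seen through the cutoff \<open>h\<close> at scale \<open>exp t\<close>
  at most \<open>\<Prod>j=1..m - 1. 4 j\<^sup>2\<close>, the value for which \<open>u\<close> behaves like \<open>- log |x|\<close>.\<close>

lemma mean_euler_ge:
  assumes u: "smooth u" and m: "DIM('a) = 2 * m" "m \<ge> 2"
    and int_f: "integrable lborel ((neg_laplacian ^^ m) u)"
    and f_le: "\<And>x. (neg_laplacian ^^ m) u x \<le> w x" and w_nonneg: "\<And>x. 0 \<le> w x"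
    and int_w: "integrable lborel w"
    and w: "(\<integral>x. w x \<partial>lborel) \<le> real DIM('a) * unit_ball_vol (real DIM('a)) * (\<Prod>j=1..m - 1. 4 * (real j)\<^sup>2)"
    and "compact K"
    and K: "\<And>x. x \<notin> K \<Longrightarrow> (real DIM('a) - 2) / 2 * (norm (gradient u x))\<^sup>2 \<le> neg_laplacian u x"
  shows "mean (euler u) t \<ge> -1"
proof -
  have "m > 0" using m by simp
  obtain h where h': "\<And>s. (h has_real_derivative - (s ^ (m - 1) * g s) / 2) (at s)"
    and h4: "\<And>s. s \<ge> 4 \<Longrightarrow> h s = 0" and h_nonneg: "\<And>s. 0 \<le> h s" and h_le: "\<And>s. s \<ge> 0 \<Longrightarrow> h s \<le> h 0"
    and h0: "real DIM('a) * unit_ball_vol (real DIM('a)) * h 0 = 1"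
    using ex_cutoff[OF \<open>m > 0\<close> m(1)] by metis
  have cont_h': "continuous_on UNIV (\<lambda>s. - (s ^ (m - 1) * g s) / 2)"
    by (intro continuous_intros has_real_derivative_continuous[OF g']) auto
  have h4': "h s = 0" if "s > 4" for s using h4 that by simp
  define f where "f = (neg_laplacian ^^ m) u"
  define R where "R = (\<Prod>j=1..m - 1. [:4 * (real j)\<^sup>2, 0, -1:])"
  have R0: "poly R 0 = (\<Prod>j=1..m - 1. 4 * (real j)\<^sup>2)" by (simp add: R_def poly_prod)
  have cont_f: "continuous_on UNIV f"
    unfolding f_def by (intro smooth_continuous smooth_neg_laplacian_funpow u)
  let ?s = "\<lambda>t x::'a. (x \<bullet> x) * exp (- 2 * t)"
  define F where "F t = (\<integral>x. h (?s t x) * f x \<partial>lborel)" for t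
  have int_hf: "integrable lborel (\<lambda>x. h (?s t x) * f x)" for t
    by (rule integrable_dilated(1)[OF h' cont_h' h4' cont_f])
  have F': "(F has_real_derivative - euler_poly_mean u (pCons 0 (pCons 0 R)) t) (at t)" for t
  proof -
    have "(F has_real_derivative (\<integral>x. - 2 * ?s t x * (- (?s t x ^ (m - 1) * g (?s t x)) / 2) * f x \<partial>lborel)) (at t)"
      unfolding F_def by (rule has_derivative_dilated_integral[OF h' cont_h' h4' cont_f])
    \<comment> \<open>The choice of \<open>h'\<close> turns the rate of change of the mass in the
      ball into a mean over the shell, to which \<open>mean_neg_laplacian_funpow\<close>
      applies.\<close>
    also have "(\<integral>x. - 2 * ?s t x * (- (?s t x ^ (m - 1) * g (?s t x)) / 2) * f x \<partial>lborel)
        = mean (\<lambda>x. (x \<bullet> x) ^ m * f x) t"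
    proof -
      have "s * s ^ (m - 1) = s ^ m" for s :: real
        using \<open>m > 0\<close> by (metis power_minus_mult mult.commute)
      then have "- 2 * s * (- (s ^ (m - 1) * c) / 2) * y = s ^ m * c * y" for s c y :: real
        by (simp add: mult.assoc[symmetric])
      then have "(\<integral>x. - 2 * ?s t x * (- (?s t x ^ (m - 1) * g (?s t x)) / 2) * f x \<partial>lborel)
          = (\<integral>x. ?s t x ^ m * g (?s t x) * f x \<partial>lborel)"
        by (intro Bochner_Integration.integral_cong refl)
      also have "\<dots> = (\<integral>x. exp (- 2 * t) ^ m * (g (?s t x) * ((x \<bullet> x) ^ m * f x)) \<partial>lborel)"
        by (intro Bochner_Integration.integral_cong refl) (simp only: power_mult_distrib mult_ac)
      also have "\<dots> = exp (- 2 * t) ^ m * (\<integral>x. g (?s t x) * ((x \<bullet> x) ^ m * f x) \<partial>lborel)"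
        by (rule integral_mult_right_zero)
      also have "exp (- 2 * t) ^ m = exp (- real DIM('a) * t)"
        by (simp add: m exp_of_nat_mult[symmetric] mult_ac)
      finally show ?thesis unfolding mean_def .
    qed
    also have "\<dots> = - euler_poly_mean u (pCons 0 (pCons 0 R)) t"
    proof -
      interpret L: shift_functional "euler_poly_mean u" by (rule shift_functional_euler_poly_mean[OF u])
      have "mean (\<lambda>x. (x \<bullet> x) ^ m * f x) t = euler_poly_mean u (- pCons 0 (pCons 0 R)) t"
        using mean_neg_laplacian_funpow[OF u, of m t]
        unfolding f_def R_def prod_euler_factors[OF \<open>m > 0\<close>, symmetric] m(1) .
      moreover have "euler_poly_mean u (- p) t = - euler_poly_mean u p t" for p
        using L.smult[of "-1" p t] by simp
      ultimately show ?thesis by (simp only:)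
    qed
    finally show ?thesis .
  qed
  have F_le: "F t \<le> poly R 0" for t
  proof -
    have "F t \<le> (\<integral>x. h 0 * w x \<partial>lborel)"
      unfolding F_def
    proof (rule integral_mono[OF int_hf])
      show "integrable lborel (\<lambda>x. h 0 * w x)" using int_w by simp
      fix x :: 'a
      \<comment> \<open>\<open>f\<close> may be negative, so it is replaced by the nonnegative
        \<open>w\<close> before \<open>h\<close> is replaced by its maximum
        \<open>h 0\<close>.\<close>
      have "h (?s t x) * f x \<le> h (?s t x) * w x"
        unfolding f_def by (intro mult_left_mono f_le h_nonneg)
      also have "\<dots> \<le> h 0 * w x" by (intro mult_right_mono h_le w_nonneg) simp
      finally show "h (?s t x) * f x \<le> h 0 * w x" .
    qed
    also have "\<dots> = h 0 * (\<integral>x. w x \<partial>lborel)" by simp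
    also have "\<dots> \<le> h 0 * (real DIM('a) * unit_ball_vol (real DIM('a)) * poly R 0)"
      unfolding R0 by (intro mult_left_mono w h_nonneg)
    also have "\<dots> = (real DIM('a) * unit_ball_vol (real DIM('a)) * h 0) * poly R 0"
      by (simp add: mult_ac)
    finally show ?thesis unfolding h0 by simp
  qed
  have F_bot: "(F \<longlongrightarrow> 0) at_bot"
    unfolding filterlim_at_bot_mirror
  proof -
    have "((\<lambda>t. F (- t)) \<longlongrightarrow> (\<integral>x. 0 \<partial>(lborel :: 'a measure))) at_top"
      unfolding F_def
    proof (rule integral_dominated_convergence_at_top[where w = "\<lambda>x. h 0 * \<bar>f x\<bar>"])
      show "integrable lborel (\<lambda>x. h 0 * \<bar>f x\<bar>)" using int_f by (simp add: f_def)
      show "(\<lambda>x. h (?s (- t) x) * f x) \<in> borel_measurable lborel" for t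
        using borel_measurable_integrable[OF int_hf] .
      show "\<forall>\<^sub>F t in at_top. AE x in lborel. norm (h (?s (- t) x) * f x) \<le> h 0 * \<bar>f x\<bar>"
        using h_nonneg h_le by (auto intro!: always_eventually AE_I2 mult_right_mono simp: abs_mult)
      \<comment> \<open>At the origin the cutoff keeps the value \<open>h 0\<close> for all
        \<open>t\<close>; everywhere else it is eventually 0.\<close>
      have "AE x in lborel. x \<noteq> (0::'a)" by (rule AE_lborel_singleton)
      then show "AE x in lborel. ((\<lambda>t. h (?s (- t) x) * f x) \<longlongrightarrow> 0) at_top"
      proof eventually_elim
        fix x :: 'a assume "x \<noteq> 0"
        then have "filterlim (\<lambda>t. (x \<bullet> x) * exp (2 * t)) at_top at_top"
          by (intro filterlim_tendsto_pos_mult_at_top[OF tendsto_const] filterlim_compose[OF exp_at_top]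
              filterlim_ident) auto
        then have "\<forall>\<^sub>F t in at_top. (x \<bullet> x) * exp (2 * t) \<ge> 4" by (simp add: filterlim_at_top)
        then have "\<forall>\<^sub>F t in at_top. h (?s (- t) x) * f x = 0"
          by eventually_elim (simp add: h4)
        then show "((\<lambda>t. h (?s (- t) x) * f x) \<longlongrightarrow> 0) at_top" by (rule tendsto_eventually)
      qed
    qed simp
    then show "((\<lambda>t. F (- t)) \<longlongrightarrow> 0) at_top" by simp
  qed
  interpret L: shift_functional "euler_poly_mean u" by (rule shift_functional_euler_poly_mean[OF u])
  \<comment> \<open>Integrates \<open>F'\<close> once: the sum of both functions is constant, and
    both tend to 0 at minus infinity.\<close>
  have F_eq: "euler_poly_mean u (pCons 0 R) t = - F t" for t
  proof -
    let ?D = "\<lambda>t. euler_poly_mean u (pCons 0 R) t + F t"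
    have "(?D has_real_derivative 0) (at t)" for t
      using DERIV_add[OF L.deriv[of "pCons 0 R" t] F'[of t]] by simp
    then have D: "?D s = ?D t" for s by (intro DERIV_isconst_all allI)
    have "(?D \<longlongrightarrow> 0 + 0) at_bot"
      by (intro tendsto_add euler_poly_mean_at_bot[OF u] F_bot)
    moreover have "(?D \<longlongrightarrow> ?D t) at_bot"
      using D by (intro tendsto_eventually always_eventually) blast
    ultimately have "?D t = 0 + 0" by (intro tendsto_unique) auto
    then show ?thesis by simp
  qed
  \<comment> \<open>This is \<open>p(d/dt)\<close> applied to \<open>mean (euler u) + 1\<close>,
    since \<open>p(d/dt)\<close> maps the constant 1 to \<open>poly p 0\<close>.\<close>
  define M where "M p t = euler_poly_mean u (pCons 0 p) t + poly p 0" for p t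
  interpret M: shift_functional M
  proof
    fix p q :: "real poly" and c t
    have "pCons 0 (p + q) = pCons 0 p + pCons 0 q" "pCons 0 (smult c p) = smult c (pCons 0 p)" by simp_all
    then show "M (p + q) t = M p t + M q t" "M (smult c p) t = c * M p t"
      by (simp_all only: M_def L.add L.smult poly_add poly_smult) (simp_all add: algebra_simps)
    show "(M p has_real_derivative M (pCons 0 p) t) (at t)"
      unfolding M_def[abs_def] using DERIV_add[OF L.deriv[of "pCons 0 p" t] DERIV_const] by simp
  qed
  have M1: "M 1 = (\<lambda>t. mean (euler u) t + 1)"
  proof
    show "M 1 t = mean (euler u) t + 1" for t
      unfolding M_def euler_poly_mean_pCons by simp
  qed
  have "M 1 t \<ge> 0"
  proof (rule M.maximum_principle)
    \<comment> \<open>The value is \<open>poly R 0 - F t\<close>; the volume bound enters here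
      through \<open>F_le\<close>.\<close>
    show "M (\<Prod>j=1..m - 1. [:4 * (real j)\<^sup>2, 0, -1:]) t \<ge> 0" for t
      unfolding R_def[symmetric] M_def F_eq using F_le[of t] by simp
    show "(M p \<longlongrightarrow> poly p 0) at_bot" for p
      unfolding M_def[abs_def]
      using tendsto_add[OF euler_poly_mean_at_bot[OF u, of p] tendsto_const[of "poly p 0"]] by simp
    show "\<not> grows \<kappa> (M 1)" if "\<kappa> > 0" for \<kappa>
      unfolding M1 using m by (intro mean_euler_not_grows[OF u _ \<open>compact K\<close> K that]) auto
  qed
  then show ?thesis by (simp add: M1)
qed

text \<open>Otherwise \<open>mean u t + t\<close> is nondecreasing. By Jensen the weighted volume of
  the shell at scale \<open>exp t\<close> then stays above \<open>exp (n * mean u 0)\<close> for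
  \<open>t >= 0\<close>, whereas integrability makes it tend to 0.\<close>

lemma mean_euler_not_ge:
  assumes u: "smooth u" and int: "integrable lborel (\<lambda>x. exp (real DIM('a) * u x))"
  shows "\<exists>t. mean (euler u) t < -1"
proof (rule ccontr)
  assume "\<not> ?thesis"
  then have ge: "mean (euler u) t \<ge> -1" for t by (simp add: not_less)
  let ?n = "real DIM('a)" and ?w = "\<lambda>x. exp (real DIM('a) * u x)"
  have cont: "continuous_on UNIV u" by (rule smooth_continuous[OF u])
  have lower: "exp (?n * mean u 0) \<le> (\<integral>x. g ((x \<bullet> x) * exp (- 2 * t)) * ?w x \<partial>lborel)" if "t \<ge> 0" for t
  proof -
    have "mean u 0 + 0 \<le> mean u t + t"
    proof (rule DERIV_nonneg_imp_nondecreasing[OF that])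
      fix s
      have "((\<lambda>t. mean u t + t) has_real_derivative mean (euler u) s + 1) (at s)"
        by (intro DERIV_add has_derivative_mean u DERIV_ident)
      then show "\<exists>y. ((\<lambda>t. mean u t + t) has_real_derivative y) (at s) \<and> 0 \<le> y"
        using ge[of s] by (intro exI conjI) auto
    qed
    then have "exp (?n * mean u 0) \<le> exp (?n * t + ?n * mean u t)"
      by (simp add: distrib_left[symmetric] add.commute)
    also have "\<dots> = exp (?n * t) * exp (mean (\<lambda>x. ?n * u x) t)"
      by (simp add: exp_add mean_cmult)
    also have "\<dots> \<le> exp (?n * t) * mean ?w t"
      by (intro mult_left_mono mean_exp_ge continuous_intros cont) auto
    also have "\<dots> = (\<integral>x. g ((x \<bullet> x) * exp (- 2 * t)) * ?w x \<partial>lborel)"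
      by (simp add: mean_def mult.assoc[symmetric] exp_add[symmetric])
    finally show ?thesis .
  qed
  have "((\<lambda>t. \<integral>x. g ((x \<bullet> x) * exp (- 2 * t)) * ?w x \<partial>lborel) \<longlongrightarrow> 0) at_top"
    by (rule integral_bump_at_top[OF int])
      (auto intro!: borel_measurable_continuous_onI continuous_intros cont)
  moreover have "\<forall>\<^sub>F t in at_top. exp (?n * mean u 0) \<le> (\<integral>x. g ((x \<bullet> x) * exp (- 2 * t)) * ?w x \<partial>lborel)"
    using eventually_ge_at_top[of 0] by eventually_elim (rule lower)
  ultimately have "exp (?n * mean u 0) \<le> 0"
    by (intro tendsto_lowerbound) auto
  then show False by simp
qed

end

section \<open>The volume bound\<close>

lemma Gamma_nat_plus_half:
  "Gamma (real m + 1 / 2) = sqrt pi * fact (2 * m) / (4 ^ m * fact m)"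
proof (induction m)
  case 0
  then show ?case by (simp add: Gamma_one_half_real)
next
  case (Suc m)
  have "real m + 1 / 2 \<notin> \<int>\<^sub>\<le>\<^sub>0" by (auto elim!: nonpos_Ints_cases simp: field_simps)
  from Gamma_plus1[OF this] have "Gamma (real (Suc m) + 1 / 2) = (real m + 1 / 2) * Gamma (real m + 1 / 2)"
    by (simp add: algebra_simps)
  also have "\<dots> = sqrt pi * fact (2 * Suc m) / (4 ^ Suc m * fact (Suc m))"
    unfolding Suc.IH by (simp add: divide_simps) (simp add: algebra_simps)
  finally show ?case .
qed

lemma unit_sphere_volume_even:
  assumes "CARD('n::finite) = 2 * m"
  shows "unit_sphere_volume TYPE(real^'n) = ennreal (2 * pi ^ m * 4 ^ m * fact m / fact (2 * m))"
proof -
  have "pi powr ((real CARD('n) + 1) / 2) = pi ^ m * sqrt pi"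
    by (simp add: assms add_divide_distrib powr_add powr_half_sqrt powr_realpow)
  moreover have "(real CARD('n) + 1) / 2 = real m + 1 / 2" by (simp add: assms add_divide_distrib)
  ultimately have "2 * pi powr ((real CARD('n) + 1) / 2) / Gamma ((real CARD('n) + 1) / 2)
      = 2 * (pi ^ m * sqrt pi) / (sqrt pi * fact (2 * m) / (4 ^ m * fact m))"
    by (simp only: Gamma_nat_plus_half)
  also have "\<dots> = 2 * pi ^ m * 4 ^ m * fact m / fact (2 * m)" by simp
  finally show ?thesis unfolding unit_sphere_volume_eq by (simp only:)
qed

text \<open>This is where the constant of the theorem comes from. The left side bounds the total
  Q-curvature when the volume is at most half that of the sphere. The right side is the area of the
  unit sphere in dimension \<open>2 m\<close> times the value at 0 of the characteristic
  polynomial.\<close>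

lemma half_sphere_volume_identity:
  assumes "m > 0"
  shows "fact (2 * m - 1) * (2 * pi ^ m * 4 ^ m * fact m / fact (2 * m) / 2)
    = real (2 * m) * unit_ball_vol (real (2 * m)) * (\<Prod>j=1..m - 1. 4 * (real j)\<^sup>2)"
proof -
  define k where "k = m - 1"
  then have m: "m = Suc k" using assms by simp
  have prod: "(\<Prod>j=1..k. 4 * (real j)\<^sup>2) = 4 ^ k * (fact k)\<^sup>2"
    by (simp add: prod.distrib fact_prod prod_power_distrib)
  have fact_2m: "fact (2 * m) = real (2 * m) * fact (2 * m - 1)"
    using assms by (subst fact_reduce) auto
  have fact_m: "fact m = real m * fact k" and four: "(4::real) ^ m = 4 * 4 ^ k" by (simp_all add: m)
  \<comment> \<open>\<open>F\<close>, \<open>p\<close>, \<open>q\<close>, \<open>a\<close> stand for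
    \<open>fact (2 * m - 1)\<close>, \<open>pi ^ m\<close>, \<open>4 ^ k\<close>,
    \<open>fact k\<close>.\<close>
  have "F * (2 * p * (4 * q) * (real m * a) / (real (2 * m) * F) / 2)
      = real (2 * m) * (p / (real m * a)) * (q * a\<^sup>2)" if "F \<noteq> 0" "a \<noteq> 0" for F p q a :: real
    using that assms by (simp add: divide_simps power2_eq_square)
  then show ?thesis
    unfolding unit_ball_vol_even k_def[symmetric] prod fact_2m fact_m four
    by this (rule fact_nonzero)+
qed

theorem theorem1p1:
  fixes u :: "real^'n \<Rightarrow> real"
  assumes "CARD('n) \<ge> 4" and "even CARD('n)"
    and "smooth u"
    and "integrable lborel (\<lambda>x. Q_curvature u x * exp (real CARD('n) * u x))"
    and "\<forall>x. Q_curvature u x \<le> fact (CARD('n) - 1)"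
    and "\<exists>K. compact K \<and> (\<forall>x. x \<notin> K \<longrightarrow> scalar_curvature u x \<ge> 0)"
  shows "(\<integral>\<^sup>+ x. ennreal (exp (real CARD('n) * u x)) \<partial>lborel) > unit_sphere_volume TYPE(real^'n) / 2"
proof (rule ccontr)
  let ?n = "real CARD('n)" and ?E = "\<lambda>x. exp (real CARD('n) * u x)"
  obtain m where n: "CARD('n) = 2 * m" using \<open>even CARD('n)\<close> by (auto elim: evenE)
  then have m: "m \<ge> 2" using \<open>CARD('n) \<ge> 4\<close> by simp
  define V where "V = 2 * pi ^ m * 4 ^ m * fact m / fact (2 * m) / 2"
  have "V \<ge> 0" by (simp add: V_def)
  have "unit_sphere_volume TYPE(real^'n) / 2 = ennreal V"
    unfolding unit_sphere_volume_even[OF n] V_def by (subst ennreal_divide_numeral) simp_all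
  moreover assume "\<not> ?thesis"
  ultimately have le: "(\<integral>\<^sup>+ x. ennreal (?E x) \<partial>lborel) \<le> ennreal V" by (simp add: not_less)
  have cont: "continuous_on UNIV ?E"
    by (intro continuous_intros smooth_continuous \<open>smooth u\<close>)
  then have meas: "?E \<in> borel_measurable lborel" using borel_measurable_continuous_onI by simp
  \<comment> \<open>The negated claim itself makes the volume finite.\<close>
  have int: "integrable lborel ?E"
  proof (rule integrableI_bounded[OF meas])
    show "(\<integral>\<^sup>+ x. ennreal (norm (?E x)) \<partial>lborel) < \<infinity>"
      using le by (auto simp: le_less_trans)
  qed
  have "(\<integral>x. ?E x \<partial>lborel) \<le> V"
    using le \<open>V \<ge> 0\<close> by (subst (asm) nn_integral_eq_integral[OF int]) auto
  obtain K where "compact K" and K: "\<And>x. x \<notin> K \<Longrightarrow> scalar_curvature u x \<ge> 0"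
    using assms(6) by blast
  have f: "(neg_laplacian ^^ m) u x = Q_curvature u x * ?E x" for x
    using Q_curvature_equation[of u x] by (simp add: n)
  obtain g g' where bump: "radial_bump TYPE(real^'n) g g'" using ex_radial_bump by blast
  let ?z = "radial_bump.mean g (euler u)"
  \<comment> \<open>The majorant \<open>w\<close> of \<open>mean_euler_ge\<close> is
    \<open>(n-1)!\<close> times the volume density. The volume may equal \<open>V\<close> here, so
    equality is excluded too and the final inequality is strict.\<close>
  have "?z t \<ge> -1" for t
  proof (rule radial_bump.mean_euler_ge[OF bump \<open>smooth u\<close> _ m])
    show "integrable lborel ((neg_laplacian ^^ m) u)"
      using assms(4) by (simp add: f[abs_def])
    show "(neg_laplacian ^^ m) u x \<le> fact (2 * m - 1) * ?E x" for x
      unfolding f using assms(5) by (intro mult_right_mono) (auto simp: n)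
    show "integrable lborel (\<lambda>x. fact (2 * m - 1) * ?E x)" using int by simp
    have "(\<integral>x. fact (2 * m - 1) * ?E x \<partial>lborel) \<le> fact (2 * m - 1) * V"
      using \<open>(\<integral>x. ?E x \<partial>lborel) \<le> V\<close> by simp
    then show "(\<integral>x. fact (2 * m - 1) * ?E x \<partial>lborel) \<le> real DIM(real^'n)
        * unit_ball_vol (real DIM(real^'n)) * (\<Prod>j=1..m - 1. 4 * (real j)\<^sup>2)"
      using half_sphere_volume_identity[of m] m by (simp add: V_def n)
    show "(real DIM(real^'n) - 2) / 2 * (norm (gradient u x))\<^sup>2 \<le> neg_laplacian u x" if "x \<notin> K" for x
    proof -
      have "0 < 2 * (?n - 1) * exp (- 2 * u x)" using \<open>CARD('n) \<ge> 4\<close> by simp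
      with K[OF that] show ?thesis
        by (simp add: scalar_curvature_def neg_laplacian_def zero_le_mult_iff)
    qed
  qed (use \<open>compact K\<close> n in auto)
  moreover obtain t where "?z t < -1"
    using radial_bump.mean_euler_not_ge[OF bump \<open>smooth u\<close>] int by auto
  ultimately show False by (meson not_less)
qed

end
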